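(* Let $f:\Sigma\to\mathcal{Z}$ be a regular umbilic-free Lie applicable Legendre map with curvature subbundles $T_1,T_2$, and let $i\in\{1,2\}$. Then $f$ has spherical curvature lines along the leaves of $T_i$ if and only if any Calapso transform $f^t$ of $f$ has spherical curvature lines along the leaves of $T_i$.
   Context: Let $\mathbb{R}^{4,2}$ be $\mathbb{R}^6$ with a symmetric bilinear form $(\cdot,\cdot)$ of signature $(4,2)$, $\mathcal{L}$ its light cone, $\mathcal{Z}$ the Grassmannian of totally isotropic 2-planes, and $\wedge^2\mathbb{R}^{4,2}\cong\mathfrak{o}(4,2)$ via $(a\wedge b)c=(a,c)b-(b,c)a$. $\Sigma$ is a simply connected 2-manifold. A smooth map $f:\Sigma\to\mathcal{Z}$ is identified with a rank 2 null subbundle of $\Sigma\times\mathbb{R}^{4,2}$; $f^{(1)}$ is the set of sections and derivatives of sections of $f$. $f$ is a Legendre map if $f^{(1)}\le f^\perp$ and, for any $x$, if $X\in T_x\Sigma$ satisfies $d\sigma(X)\in f$ for all $\sigma\in\Gamma f$, then $X=0$. $f$ is umbilic-free if there are rank 1 subbundles (curvature sphere congruences) $s_1,s_2\le f$ with $s_1\cap s_2=\{0\}$ and rank 1 curvature subbundles $T_1,T_2\le T\Sigma$ with $d_X\sigma_i\in\Gamma f$ for $\sigma_i\in\Gamma s_i$, $X\in\Gamma T_i$; the leaves of $T_i$ are the curvature lines. $f$ is regular if $s_1,s_2:\Sigma\to\mathbb{P}(\mathcal{L})$ are immersions. A Legendre map has spherical curvature lines along the leaves of $T_i$ if these leaves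 are curvature lines and there is a spacelike rank 1 subbundle of $f^\perp$ constant along them (the Lie-invariant form of: in any conformal Riemannian subgeometry they lie on spheres meeting the surface transversally). $f$ is Lie applicable if there is a gauge potential $\eta\in\Omega^1(f\wedge f^\perp)$ with $d\eta=[\eta\wedge\eta]=0$ such that $\mathcal{Q}^\eta(X,Y)=\mathrm{tr}(f\to f:\sigma\mapsto\eta(X)d_Y\sigma)$ is non-zero. Then $\{d+t\eta\}_{t\in\mathbb{R}}$ are flat metric connections and there are local orthogonal trivialising gauge transformations $T(t):\Sigma\to\mathrm{O}(4,2)$ with $T(t)\circ(d+t\eta)\circ T(t)^{-1}=d$; the Legendre maps $f^t:=T(t)f$ are the Calapso transforms of $f$. *)

theory Defs
  imports "HOL-Analysis.Analysis"
begin

section \<open>Smooth manifolds of dimension two\<close>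

text \<open>The following notions are meant for open sets \<open>S\<close> only: derivatives are taken at the points
  of \<open>S\<close>, not within \<open>S\<close>.\<close>

primrec Ck_on :: "nat \<Rightarrow> 'a::real_normed_vector set \<Rightarrow> ('a \<Rightarrow> 'b::real_normed_vector) \<Rightarrow> bool" where
  "Ck_on 0 S f \<longleftrightarrow> continuous_on S f"
| "Ck_on (Suc k) S f \<longleftrightarrow> (\<forall>x\<in>S. f differentiable (at x)) \<and>
     (\<forall>v. Ck_on k S (\<lambda>x. frechet_derivative f (at x) v))"

definition smooth_on :: "'a::real_normed_vector set \<Rightarrow> ('a \<Rightarrow> 'b::real_normed_vector) \<Rightarrow> bool" where
  "smooth_on S f \<longleftrightarrow> (\<forall>k. Ck_on k S f)"

text \<open>A chart is a pair of its domain and its coordinate map; the values of the coordinate map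
  outside the domain are irrelevant.\<close>

type_synonym 'a chart = "'a set \<times> ('a \<Rightarrow> real^2)"

definition chart_inv :: "'a chart \<Rightarrow> real^2 \<Rightarrow> 'a" where
  "chart_inv c = inv_into (fst c) (snd c)"

definition charts_at :: "'a chart set \<Rightarrow> 'a \<Rightarrow> 'a chart set" where
  "charts_at A x = {c \<in> A. x \<in> fst c}"

definition smooth_atlas :: "('a::topological_space) chart set \<Rightarrow> bool" where
  "smooth_atlas A \<longleftrightarrow>
     (\<forall>c\<in>A. open (fst c) \<and> open (snd c ` fst c) \<and>
            homeomorphism (fst c) (snd c ` fst c) (snd c) (chart_inv c)) \<and>
     (\<Union>c\<in>A. fst c) = UNIV \<and>
     (\<forall>c\<in>A. \<forall>d\<in>A. smooth_on (snd c ` (fst c \<inter> fst d)) (snd d \<circ> chart_inv c))"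

definition smooth_map ::
  "'a chart set \<Rightarrow> 'a set \<Rightarrow> ('a \<Rightarrow> 'b::real_normed_vector) \<Rightarrow> bool" where
  "smooth_map A U \<sigma> \<longleftrightarrow> (\<forall>c\<in>A. smooth_on (snd c ` (U \<inter> fst c)) (\<sigma> \<circ> chart_inv c))"

text \<open>A tangent vector at \<open>x\<close> is given by its components in all charts around \<open>x\<close>, which are
  related by the Jacobians of the coordinate changes. The components in all other charts are
  set to \<open>0\<close>, so that equality of tangent vectors is equality of functions.\<close>

type_synonym 'a tangent = "'a chart \<Rightarrow> real^2"

definition tangent_space :: "'a chart set \<Rightarrow> 'a \<Rightarrow> 'a tangent set" where
  "tangent_space A x = {X.
     (\<forall>c\<in>charts_at A x. \<forall>d\<in>charts_at A x.
        X d = frechet_derivative (snd d \<circ> chart_inv c) (at (snd c x)) (X c)) \<and>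
     (\<forall>c. c \<notin> charts_at A x \<longrightarrow> X c = 0)}"

text \<open>The derivative \<open>d\<^sub>X \<sigma>\<close> of a vector-valued map at \<open>x\<close>. By the chain rule it does not depend
  on the chart at \<open>x\<close> used to compute it.\<close>

definition dirderiv ::
  "'a chart set \<Rightarrow> 'a \<Rightarrow> 'a tangent \<Rightarrow> ('a \<Rightarrow> 'b::real_normed_vector) \<Rightarrow> 'b" where
  "dirderiv A x X \<sigma> = (let c = SOME c. c \<in> charts_at A x
     in frechet_derivative (\<sigma> \<circ> chart_inv c) (at (snd c x)) (X c))"

text \<open>The coordinate vector field of the chart \<open>c\<close> with constant components \<open>v\<close>; it is
  meaningful on the domain of \<open>c\<close>.\<close>

definition coord_field :: "'a chart set \<Rightarrow> 'a chart \<Rightarrow> real^2 \<Rightarrow> 'a \<Rightarrow> 'a tangent" where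
  "coord_field A c v p = (\<lambda>d. if d \<in> charts_at A p
     then frechet_derivative (snd d \<circ> chart_inv c) (at (snd c p)) v else 0)"

definition smooth_vector_field :: "'a chart set \<Rightarrow> 'a set \<Rightarrow> ('a \<Rightarrow> 'a tangent) \<Rightarrow> bool" where
  "smooth_vector_field A U Z \<longleftrightarrow> (\<forall>p\<in>U. Z p \<in> tangent_space A p) \<and>
     (\<forall>c\<in>A. smooth_on (snd c ` (U \<inter> fst c)) (\<lambda>y. Z (chart_inv c y) c))"

definition rank1_tangent_subbundle ::
  "('a::topological_space) chart set \<Rightarrow> ('a \<Rightarrow> 'a tangent set) \<Rightarrow> bool" where
  "rank1_tangent_subbundle A D \<longleftrightarrow> (\<forall>x. \<exists>U Z. open U \<and> x \<in> U \<and> smooth_vector_field A U Z \<and>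
     (\<forall>p\<in>U. Z p \<noteq> (\<lambda>c. 0) \<and> D p = {(\<lambda>c. r *\<^sub>R Z p c) |r. True}))"

definition velocity :: "'a chart set \<Rightarrow> (real \<Rightarrow> 'a) \<Rightarrow> real \<Rightarrow> 'a tangent" where
  "velocity A \<gamma> s = (\<lambda>c. if c \<in> charts_at A (\<gamma> s)
     then vector_derivative (snd c \<circ> \<gamma>) (at s) else 0)"

definition integral_curve ::
  "('a::topological_space) chart set \<Rightarrow> ('a \<Rightarrow> 'a tangent set) \<Rightarrow> real set \<Rightarrow> (real \<Rightarrow> 'a) \<Rightarrow> bool" where
  "integral_curve A D J \<gamma> \<longleftrightarrow> open J \<and> connected J \<and> continuous_on J \<gamma> \<and>
     (\<forall>c\<in>A. smooth_on {s \<in> J. \<gamma> s \<in> fst c} (snd c \<circ> \<gamma>)) \<and>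
     (\<forall>s\<in>J. velocity A \<gamma> s \<in> D (\<gamma> s))"

text \<open>The leaf through \<open>x\<close> of a rank one distribution: all points that can be joined to \<open>x\<close> by
  a smooth curve tangent to the distribution.\<close>

definition leaf :: "('a::topological_space) chart set \<Rightarrow> ('a \<Rightarrow> 'a tangent set) \<Rightarrow> 'a \<Rightarrow> 'a set" where
  "leaf A D x = {y. \<exists>J \<gamma> a b. integral_curve A D J \<gamma> \<and> a \<in> J \<and> b \<in> J \<and> \<gamma> a = x \<and> \<gamma> b = y}"

section \<open>The space of signature (4,2)\<close>

definition signature_4_2 :: "(real^6 \<Rightarrow> real^6 \<Rightarrow> real) \<Rightarrow> bool" where
  "signature_4_2 B \<longleftrightarrow> bilinear B \<and> (\<forall>u v. B u v = B v u) \<and>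
     (\<exists>e :: nat \<Rightarrow> real^6. span (e ` {..<6}) = UNIV \<and>
        (\<forall>i<6. \<forall>j<6. B (e i) (e j) = (if i = j then (if i < 4 then 1 else -1) else 0)))"

definition perp :: "(real^6 \<Rightarrow> real^6 \<Rightarrow> real) \<Rightarrow> (real^6) set \<Rightarrow> (real^6) set" where
  "perp B W = {v. \<forall>w\<in>W. B v w = 0}"

definition orthogonal_group :: "(real^6 \<Rightarrow> real^6 \<Rightarrow> real) \<Rightarrow> (real^6^6) set" where
  "orthogonal_group B = {M. \<forall>u v. B (M *v u) (M *v v) = B u v}"

text \<open>The element \<open>a \<and> b\<close>, as the endomorphism \<open>c \<mapsto> (a,c) b - (b,c) a\<close> of \<open>\<real>\<^sup>6\<close>.\<close>

definition wedge :: "(real^6 \<Rightarrow> real^6 \<Rightarrow> real) \<Rightarrow> real^6 \<Rightarrow> real^6 \<Rightarrow> real^6^6" where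
  "wedge B a b = matrix (\<lambda>c. B a c *\<^sub>R b - B b c *\<^sub>R a)"

definition wedge_space ::
  "(real^6 \<Rightarrow> real^6 \<Rightarrow> real) \<Rightarrow> (real^6) set \<Rightarrow> (real^6) set \<Rightarrow> (real^6^6) set" where
  "wedge_space B V W = span {wedge B a b |a b. a \<in> V \<and> b \<in> W}"

text \<open>Trace of an endomorphism of a subspace, computed in some basis.\<close>

definition trace_on :: "(real^6) set \<Rightarrow> (real^6 \<Rightarrow> real^6) \<Rightarrow> real" where
  "trace_on V L = (let E = SOME E. independent E \<and> span E = V
     in \<Sum>b\<in>E. representation E (L b) b)"

section \<open>Legendre maps\<close>

text \<open>Maps into Grassmannians of \<open>\<real>\<^sup>6\<close> are identified with subbundles of the trivial bundle;
  the condition below says that the map has a smooth frame near every point.\<close>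

definition subbundle ::
  "('a::topological_space) chart set \<Rightarrow> nat \<Rightarrow> ('a \<Rightarrow> (real^6) set) \<Rightarrow> bool" where
  "subbundle A k F \<longleftrightarrow> (\<forall>x. \<exists>U e. open U \<and> x \<in> U \<and> (\<forall>j<k. smooth_map A U (e j)) \<and>
     (\<forall>p\<in>U. F p = span ((\<lambda>j::nat. e j p) ` {..<k}) \<and> dim (F p) = k))"

definition local_section ::
  "('a::topological_space) chart set \<Rightarrow> ('a \<Rightarrow> (real^6) set) \<Rightarrow> 'a set \<Rightarrow> ('a \<Rightarrow> real^6) \<Rightarrow> bool" where
  "local_section A F U \<sigma> \<longleftrightarrow> open U \<and> smooth_map A U \<sigma> \<and> (\<forall>p\<in>U. \<sigma> p \<in> F p)"

text \<open>Values at \<open>x\<close> of elements of \<open>f\<^sup>(\<^sup>1\<^sup>)\<close>.\<close>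

definition derived_set ::
  "('a::topological_space) chart set \<Rightarrow> ('a \<Rightarrow> (real^6) set) \<Rightarrow> 'a \<Rightarrow> (real^6) set" where
  "derived_set A f x = {v. \<exists>U \<sigma>. local_section A f U \<sigma> \<and> x \<in> U \<and>
     (v = \<sigma> x \<or> (\<exists>X\<in>tangent_space A x. v = dirderiv A x X \<sigma>))}"

definition legendre_map ::
  "('a::topological_space) chart set \<Rightarrow> (real^6 \<Rightarrow> real^6 \<Rightarrow> real) \<Rightarrow> ('a \<Rightarrow> (real^6) set) \<Rightarrow> bool" where
  "legendre_map A B f \<longleftrightarrow>
     subbundle A 2 f \<and> (\<forall>x. \<forall>u\<in>f x. \<forall>v\<in>f x. B u v = 0) \<and>
     (\<forall>x. derived_set A f x \<subseteq> perp B (f x)) \<and>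
     (\<forall>x. \<forall>X\<in>tangent_space A x.
        (\<forall>U \<sigma>. local_section A f U \<sigma> \<longrightarrow> x \<in> U \<longrightarrow> dirderiv A x X \<sigma> \<in> f x) \<longrightarrow> X = (\<lambda>c. 0))"

text \<open>The curvature sphere congruences are \<open>s 1, s 2\<close> and the curvature subbundles \<open>T 1, T 2\<close>;
  other indices play no role.\<close>

definition umbilic_free_with ::
  "('a::topological_space) chart set \<Rightarrow> ('a \<Rightarrow> (real^6) set) \<Rightarrow>
     (nat \<Rightarrow> 'a \<Rightarrow> (real^6) set) \<Rightarrow> (nat \<Rightarrow> 'a \<Rightarrow> 'a tangent set) \<Rightarrow> bool" where
  "umbilic_free_with A f s T \<longleftrightarrow>
     (\<forall>i\<in>{1,2}. subbundle A 1 (s i) \<and> (\<forall>x. s i x \<subseteq> f x) \<and> rank1_tangent_subbundle A (T i) \<and>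
        (\<forall>U \<sigma> x X. local_section A (s i) U \<sigma> \<longrightarrow> x \<in> U \<longrightarrow> X \<in> T i x \<longrightarrow> dirderiv A x X \<sigma> \<in> f x)) \<and>
     (\<forall>x. s 1 x \<inter> s 2 x = {0})"

text \<open>Under the identification of the tangent space of projective space at a line \<open>l\<close> with
  \<open>Hom(l, \<real>\<^sup>6/l)\<close>, the differential of \<open>s\<close> at \<open>X\<close> sends \<open>\<sigma> x\<close> to the class of \<open>d\<^sub>X \<sigma>\<close>;
  an immersion is a map whose differential has trivial kernel everywhere.\<close>

definition projective_immersion ::
  "('a::topological_space) chart set \<Rightarrow> ('a \<Rightarrow> (real^6) set) \<Rightarrow> bool" where
  "projective_immersion A s \<longleftrightarrow> subbundle A 1 s \<and>
     (\<forall>x. \<forall>X\<in>tangent_space A x.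
        (\<forall>U \<sigma>. local_section A s U \<sigma> \<longrightarrow> x \<in> U \<longrightarrow> dirderiv A x X \<sigma> \<in> s x) \<longrightarrow> X = (\<lambda>c. 0))"

definition curvature_lines ::
  "('a::topological_space) chart set \<Rightarrow> ('a \<Rightarrow> (real^6) set) \<Rightarrow> ('a \<Rightarrow> 'a tangent set) \<Rightarrow> bool" where
  "curvature_lines A f D \<longleftrightarrow> (\<exists>s T. umbilic_free_with A f s T \<and> (D = T 1 \<or> D = T 2))"

definition spherical_curvature_lines ::
  "('a::topological_space) chart set \<Rightarrow> (real^6 \<Rightarrow> real^6 \<Rightarrow> real) \<Rightarrow>
     ('a \<Rightarrow> (real^6) set) \<Rightarrow> ('a \<Rightarrow> 'a tangent set) \<Rightarrow> bool" where
  "spherical_curvature_lines A B f D \<longleftrightarrow> legendre_map A B f \<and> curvature_lines A f D \<and>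
     (\<exists>L. subbundle A 1 L \<and> (\<forall>x. L x \<subseteq> perp B (f x)) \<and>
          (\<forall>x. \<forall>v\<in>L x. v \<noteq> 0 \<longrightarrow> B v v > 0) \<and>
          (\<forall>x. \<forall>y\<in>leaf A D x. L y = L x))"

section \<open>Gauge potentials and Calapso transforms\<close>

text \<open>Smooth 1-forms with values in endomorphisms of \<open>\<real>\<^sup>6\<close>.\<close>

definition one_form ::
  "'a chart set \<Rightarrow> ('a \<Rightarrow> 'a tangent \<Rightarrow> real^6^6) \<Rightarrow> bool" where
  "one_form A \<eta> \<longleftrightarrow>
     (\<forall>x. \<forall>X\<in>tangent_space A x. \<forall>Y\<in>tangent_space A x. \<forall>a b.
        \<eta> x (\<lambda>c. a *\<^sub>R X c + b *\<^sub>R Y c) = a *\<^sub>R \<eta> x X + b *\<^sub>R \<eta> x Y) \<and>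
     (\<forall>c\<in>A. \<forall>v. smooth_map A (fst c) (\<lambda>p. \<eta> p (coord_field A c v p)))"

text \<open>\<open>d\<eta>(X,Y) = d\<^sub>X(\<eta>(Y)) - d\<^sub>Y(\<eta>(X)) - \<eta>([X,Y])\<close>, where \<open>X\<close> and \<open>Y\<close> are extended to vector
  fields with constant components in a chart \<open>c\<close> at \<open>x\<close>, whose Lie bracket vanishes.\<close>

definition ext_deriv ::
  "'a chart set \<Rightarrow> 'a chart \<Rightarrow> ('a \<Rightarrow> 'a tangent \<Rightarrow> real^6^6) \<Rightarrow>
     'a \<Rightarrow> 'a tangent \<Rightarrow> 'a tangent \<Rightarrow> real^6^6" where
  "ext_deriv A c \<eta> x X Y =
     dirderiv A x X (\<lambda>p. \<eta> p (coord_field A c (Y c) p)) -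
     dirderiv A x Y (\<lambda>p. \<eta> p (coord_field A c (X c) p))"

definition closed_form :: "'a chart set \<Rightarrow> ('a \<Rightarrow> 'a tangent \<Rightarrow> real^6^6) \<Rightarrow> bool" where
  "closed_form A \<eta> \<longleftrightarrow> (\<forall>x. \<forall>X\<in>tangent_space A x. \<forall>Y\<in>tangent_space A x. \<forall>c\<in>charts_at A x.
     ext_deriv A c \<eta> x X Y = 0)"

definition lie_bracket :: "real^6^6 \<Rightarrow> real^6^6 \<Rightarrow> real^6^6" where
  "lie_bracket M N = M ** N - N ** M"

definition bracket_wedge ::
  "('a \<Rightarrow> 'a tangent \<Rightarrow> real^6^6) \<Rightarrow> ('a \<Rightarrow> 'a tangent \<Rightarrow> real^6^6) \<Rightarrow>
     'a \<Rightarrow> 'a tangent \<Rightarrow> 'a tangent \<Rightarrow> real^6^6" where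
  "bracket_wedge \<eta> \<theta> x X Y = lie_bracket (\<eta> x X) (\<theta> x Y) - lie_bracket (\<eta> x Y) (\<theta> x X)"

text \<open>The trace of \<open>\<sigma> \<mapsto> \<eta>(X) d\<^sub>Y \<sigma>\<close> on \<open>f x\<close>. For \<open>\<eta>\<close> with values in \<open>f \<and> f\<^sup>\<bottom>\<close> the vector
  \<open>\<eta>(X) d\<^sub>Y \<sigma>\<close> depends only on the value \<open>v = \<sigma> x\<close>, because \<open>\<eta>(X)\<close> annihilates \<open>f\<close>.\<close>

definition Qform ::
  "('a::topological_space) chart set \<Rightarrow> ('a \<Rightarrow> (real^6) set) \<Rightarrow> ('a \<Rightarrow> 'a tangent \<Rightarrow> real^6^6) \<Rightarrow>
     'a \<Rightarrow> 'a tangent \<Rightarrow> 'a tangent \<Rightarrow> real" where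
  "Qform A f \<eta> x X Y = trace_on (f x)
     (\<lambda>v. THE w. \<exists>U \<sigma>. local_section A f U \<sigma> \<and> x \<in> U \<and> \<sigma> x = v \<and> w = \<eta> x X *v dirderiv A x Y \<sigma>)"

definition gauge_potential ::
  "('a::topological_space) chart set \<Rightarrow> (real^6 \<Rightarrow> real^6 \<Rightarrow> real) \<Rightarrow>
     ('a \<Rightarrow> (real^6) set) \<Rightarrow> ('a \<Rightarrow> 'a tangent \<Rightarrow> real^6^6) \<Rightarrow> bool" where
  "gauge_potential A B f \<eta> \<longleftrightarrow> one_form A \<eta> \<and>
     (\<forall>x. \<forall>X\<in>tangent_space A x. \<eta> x X \<in> wedge_space B (f x) (perp B (f x))) \<and>
     closed_form A \<eta> \<and>
     (\<forall>x. \<forall>X\<in>tangent_space A x. \<forall>Y\<in>tangent_space A x. bracket_wedge \<eta> \<eta> x X Y = 0) \<and>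
     (\<exists>x. \<exists>X\<in>tangent_space A x. \<exists>Y\<in>tangent_space A x. Qform A f \<eta> x X Y \<noteq> 0)"

definition lie_applicable ::
  "('a::topological_space) chart set \<Rightarrow> (real^6 \<Rightarrow> real^6 \<Rightarrow> real) \<Rightarrow> ('a \<Rightarrow> (real^6) set) \<Rightarrow> bool" where
  "lie_applicable A B f \<longleftrightarrow> legendre_map A B f \<and> (\<exists>\<eta>. gauge_potential A B f \<eta>)"

text \<open>\<open>G\<close> is the gauge transformation \<open>T(t)\<close>; the last conjunct is
  \<open>T(t) \<circ> (d + t\<eta>) \<circ> T(t)\<^sup>-\<^sup>1 = d\<close> on local maps \<open>v\<close> into \<open>\<real>\<^sup>6\<close>.\<close>

definition trivialising_gauge ::
  "('a::topological_space) chart set \<Rightarrow> (real^6 \<Rightarrow> real^6 \<Rightarrow> real) \<Rightarrow>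
     ('a \<Rightarrow> 'a tangent \<Rightarrow> real^6^6) \<Rightarrow> real \<Rightarrow> ('a \<Rightarrow> real^6^6) \<Rightarrow> bool" where
  "trivialising_gauge A B \<eta> t G \<longleftrightarrow> smooth_map A UNIV G \<and> (\<forall>x. G x \<in> orthogonal_group B) \<and>
     (\<forall>U v x X. open U \<longrightarrow> smooth_map A U v \<longrightarrow> x \<in> U \<longrightarrow> X \<in> tangent_space A x \<longrightarrow>
        G x *v (dirderiv A x X (\<lambda>p. matrix_inv (G p) *v v p) +
                t *\<^sub>R (\<eta> x X *v (matrix_inv (G x) *v v x))) = dirderiv A x X v)"

definition calapso_transform ::
  "('a::topological_space) chart set \<Rightarrow> (real^6 \<Rightarrow> real^6 \<Rightarrow> real) \<Rightarrow>
     ('a \<Rightarrow> (real^6) set) \<Rightarrow> real \<Rightarrow> ('a \<Rightarrow> (real^6) set) \<Rightarrow> bool" where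
  "calapso_transform A B f t g \<longleftrightarrow> (\<exists>\<eta> G. gauge_potential A B f \<eta> \<and>
     trivialising_gauge A B \<eta> t G \<and> (\<forall>x. g x = (\<lambda>v. G x *v v) ` f x))"

end

theory Submission
  imports Defs
begin

text \<open>
  Let \<open>T\<^sub>i\<close> be the given curvature subbundle and \<open>T\<^sub>j\<close> the other one. The gauge potential satisfies
  \<open>\<eta>(X) w = 0\<close> for \<open>X \<in> T\<^sub>i\<close> and all \<open>w \<in> f\<^sup>\<bottom>\<close> orthogonal to the derivatives \<open>d\<^sub>X \<sigma>\<close> of sections \<open>\<sigma>\<close> of
  \<open>f\<close> (\<open>potential_annihilates_perp_derivative\<close>). Indeed, as \<open>\<eta>\<close> annihilates \<open>f\<close>, evaluating \<open>d\<eta> = 0\<close>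
  on a section of \<open>f\<close> gives \<open>\<eta>(X) d\<^sub>Y \<sigma> = \<eta>(Y) d\<^sub>X \<sigma>\<close> (\<open>closed_potential_symmetric\<close>). For \<open>\<sigma>\<close> in the
  curvature sphere congruence \<open>s\<^sub>i\<close> and \<open>Y \<in> T\<^sub>j\<close> the right-hand side vanishes. The quotient \<open>f\<^sup>\<bottom>/f\<close> is a
  Euclidean plane in which \<open>d\<^sub>X f\<close> and \<open>d\<^sub>Y f\<close> are orthogonal lines, by the symmetry of second
  derivatives (\<open>legendre_derivative_symmetric\<close>), so that \<open>w\<close> is a multiple of \<open>d\<^sub>Y \<sigma>\<close> modulo \<open>f\<close>
  (\<open>perp_isotropic_plane\<close>). Here \<open>X\<close> and \<open>Y\<close> are non-zero; for \<open>X = 0\<close> there is nothing to show.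

  Let \<open>G\<close> be the gauge transformation, so \<open>g = G f\<close>. On sections of \<open>f\<close> one has \<open>d(G \<sigma>) = G d\<sigma>\<close>, so \<open>g\<close> is
  again an umbilic-free Legendre map with the same curvature subbundles. Let the line bundle \<open>L\<close> in
  \<open>f\<^sup>\<bottom>\<close> be constant along an integral curve of \<open>T\<^sub>i\<close>, and fix \<open>v\<close> in its value. Differentiating
  \<open>(v, \<sigma>) = 0\<close> along the curve shows that \<open>v\<close> is orthogonal to the derivatives of \<open>f\<close>, hence
  \<open>d(G v) = t G \<eta> v = 0\<close> along the curve, and \<open>G L\<close> is constant there. Conversely, if a line bundle \<open>L\<close> in
  \<open>g\<^sup>\<bottom>\<close> is constant along the curve and \<open>v\<close> is in its value, then \<open>w = G\<^sup>-\<^sup>1 v\<close> satisfies \<open>dw = - t \<eta> w\<close>.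
  This derivative lies in \<open>f\<close>, so differentiating \<open>(w, \<sigma>) = 0\<close> again gives \<open>\<eta> w = 0\<close>, and \<open>w\<close> is constant.
  By definition two points of a leaf are joined by an integral curve, so that constancy along
  integral curves is constancy along leaves.
\<close>

section \<open>Calculus of smooth maps\<close>

lemma Ck_on_cong:
  assumes "open S" "Ck_on k S f" "\<And>x. x \<in> S \<Longrightarrow> f x = g x"
  shows "Ck_on k S g"
  using assms(2,3)
proof (induction k arbitrary: f g)
  case 0
  then show ?case using continuous_on_cong[of S S f g] by simp
next
  case (Suc k)
  have d: "(g has_derivative frechet_derivative f (at x)) (at x)" if "x \<in> S" for x
    using Suc.prems that frechet_derivative_works has_derivative_transform_within_open[OF _ assms(1) that]
    by (metis Ck_on.simps(2))
  then have "frechet_derivative g (at x) = frechet_derivative f (at x)" if "x \<in> S" for x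
    using frechet_derivative_at that by metis
  then have "Ck_on k S (\<lambda>x. frechet_derivative g (at x) v)" for v
    using Suc.IH[of "\<lambda>x. frechet_derivative f (at x) v" "\<lambda>x. frechet_derivative g (at x) v"] Suc.prems(1)
    by simp
  then show ?case using d by (auto simp: differentiable_def)
qed

lemma Ck_on_subset:
  assumes "S' \<subseteq> S"
  shows "Ck_on k S f \<Longrightarrow> Ck_on k S' f"
proof (induction k arbitrary: f)
  case 0
  then show ?case using continuous_on_subset[OF _ assms] by simp
next
  case (Suc k)
  then show ?case using assms by auto
qed

lemma Ck_on_SucD: "Ck_on (Suc k) S f \<Longrightarrow> Ck_on k S f"
proof (induction k arbitrary: f)
  case 0
  then show ?case
    by (auto intro!: continuous_at_imp_continuous_on differentiable_imp_continuous_within)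
next
  case (Suc k)
  have "Ck_on k S (\<lambda>x. frechet_derivative f (at x) v)" for v
    using Suc.prems by (intro Suc.IH) simp
  then show ?case using Suc.prems by simp
qed

lemma Ck_on_add:
  assumes "open S" "Ck_on k S f" "Ck_on k S g"
  shows "Ck_on k S (\<lambda>x. f x + g x)"
  using assms(2,3)
proof (induction k arbitrary: f g)
  case 0
  then show ?case by (simp add: continuous_on_add)
next
  case (Suc k)
  have d: "((\<lambda>x. f x + g x) has_derivative
      (\<lambda>v. frechet_derivative f (at x) v + frechet_derivative g (at x) v)) (at x)"
    if "x \<in> S" for x
    using Suc.prems that by (auto intro!: has_derivative_add simp: frechet_derivative_works)
  have "Ck_on k S (\<lambda>x. frechet_derivative (\<lambda>x. f x + g x) (at x) v)" for v
    using Suc.prems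
    by (rule_tac Ck_on_cong[OF assms(1) Suc.IH[of "\<lambda>x. frechet_derivative f (at x) v"
          "\<lambda>x. frechet_derivative g (at x) v"]])
       (simp_all add: frechet_derivative_at[OF d, symmetric])
  then show ?case using d by (auto simp: differentiable_def)
qed

lemma Ck_on_bilinear:
  assumes "bounded_bilinear \<beta>" "open S" "Ck_on k S f" "Ck_on k S g"
  shows "Ck_on k S (\<lambda>x. \<beta> (f x) (g x))"
  using assms(3,4)
proof (induction k arbitrary: f g)
  case 0
  then show ?case using bounded_bilinear.continuous_on[OF assms(1)] by simp
next
  case (Suc k)
  have d: "((\<lambda>x. \<beta> (f x) (g x)) has_derivative
      (\<lambda>v. \<beta> (f x) (frechet_derivative g (at x) v) + \<beta> (frechet_derivative f (at x) v) (g x))) (at x)"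
    if "x \<in> S" for x
    using Suc.prems that
    by (auto intro!: bounded_bilinear.FDERIV[OF assms(1)] simp: frechet_derivative_works)
  have "Ck_on k S (\<lambda>x. \<beta> (f x) (frechet_derivative g (at x) v) +
      \<beta> (frechet_derivative f (at x) v) (g x))" for v
    using Suc.prems Ck_on_SucD[of k S f] Ck_on_SucD[of k S g]
    by (intro Ck_on_add[OF assms(2)] Suc.IH) auto
  then have "Ck_on k S (\<lambda>x. frechet_derivative (\<lambda>x. \<beta> (f x) (g x)) (at x) v)" for v
    by (rule Ck_on_cong[OF assms(2)]) (simp add: frechet_derivative_at[OF d, symmetric])
  then show ?case using d by (auto simp: differentiable_def)
qed

lemma Ck_on_const: "Ck_on k S (\<lambda>x. c)"
  by (induction k arbitrary: c) auto

lemma Ck_on_bounded_linear: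
  assumes "bounded_linear h" "open S" "Ck_on k S f"
  shows "Ck_on k S (\<lambda>x. h (f x))"
proof -
  have "bounded_bilinear (\<lambda>(r::real) y. r *\<^sub>R h y)"
    using bounded_bilinear.comp[OF bounded_bilinear_scaleR bounded_linear_ident assms(1)] .
  from Ck_on_bilinear[OF this assms(2) Ck_on_const assms(3), of 1] show ?thesis by simp
qed

text \<open>The classical proof of the symmetry of second derivatives: two applications of the mean value
  theorem express the second difference over a small parallelogram by an iterated derivative at an
  intermediate point; the two orders of iteration are then compared in the limit.\<close>

lemma second_difference_mean_value:
  fixes \<phi> :: "'a::euclidean_space \<Rightarrow> real"
  assumes "0 < h"
    and inS: "\<And>p q. 0 \<le> p \<Longrightarrow> p \<le> h \<Longrightarrow> 0 \<le> q \<Longrightarrow> q \<le> h \<Longrightarrow> y + p *\<^sub>R a + q *\<^sub>R b \<in> S"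
    and "Ck_on 2 S \<phi>"
  obtains p q where "0 < p" "p < h" "0 < q" "q < h"
    "\<phi> (y + h *\<^sub>R a + h *\<^sub>R b) - \<phi> (y + h *\<^sub>R a) - \<phi> (y + h *\<^sub>R b) + \<phi> y =
     h * h * frechet_derivative (\<lambda>x. frechet_derivative \<phi> (at x) a) (at (y + p *\<^sub>R a + q *\<^sub>R b)) b"
proof -
  let ?A = "\<lambda>x. frechet_derivative \<phi> (at x) a"
  have d1: "(\<phi> has_derivative frechet_derivative \<phi> (at x)) (at x)"
    and d2: "(?A has_derivative frechet_derivative ?A (at x)) (at x)" if "x \<in> S" for x
    using assms(3) that by (simp_all add: numeral_2_eq_2 frechet_derivative_works)
  have aff: "((\<lambda>p. z + p *\<^sub>R v) has_derivative (\<lambda>p. p *\<^sub>R v)) (at p)" for z v :: 'a and p :: real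
    by (auto intro!: derivative_eq_intros)
  have line: "((\<lambda>p. \<phi> (z + p *\<^sub>R a)) has_real_derivative ?A (z + p *\<^sub>R a)) (at p)"
    if "z + p *\<^sub>R a \<in> S" for z p
    using diff_chain_at[OF aff d1[OF that]] linear_scale[OF has_derivative_linear[OF d1[OF that]]]
    by (simp add: has_field_derivative_def o_def mult_commute_abs)
  let ?F = "\<lambda>p. \<phi> (y + h *\<^sub>R b + p *\<^sub>R a) - \<phi> (y + p *\<^sub>R a)"
  have "DERIV ?F p :> ?A (y + h *\<^sub>R b + p *\<^sub>R a) - ?A (y + p *\<^sub>R a)" if "0 \<le> p" "p \<le> h" for p
    using inS[of p h] inS[of p 0] that assms(1)
    by (intro DERIV_diff line) (simp_all add: algebra_simps)
  then obtain p where p: "0 < p" "p < h"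
      "?F h - ?F 0 = h * (?A (y + h *\<^sub>R b + p *\<^sub>R a) - ?A (y + p *\<^sub>R a))"
    using MVT2[OF assms(1), of ?F "\<lambda>p. ?A (y + h *\<^sub>R b + p *\<^sub>R a) - ?A (y + p *\<^sub>R a)"] by auto
  have line2: "((\<lambda>q. ?A (y + p *\<^sub>R a + q *\<^sub>R b)) has_real_derivative
      frechet_derivative ?A (at (y + p *\<^sub>R a + q *\<^sub>R b)) b) (at q)" if "0 \<le> q" "q \<le> h" for q
  proof -
    have S: "y + p *\<^sub>R a + q *\<^sub>R b \<in> S" using inS that p by simp
    show ?thesis
      using diff_chain_at[OF aff d2[OF S]] linear_scale[OF has_derivative_linear[OF d2[OF S]]]
      by (simp add: has_field_derivative_def o_def mult_commute_abs)
  qed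
  obtain q where q: "0 < q" "q < h"
      "?A (y + p *\<^sub>R a + h *\<^sub>R b) - ?A (y + p *\<^sub>R a + 0 *\<^sub>R b) =
       h * frechet_derivative ?A (at (y + p *\<^sub>R a + q *\<^sub>R b)) b"
    using MVT2[OF assms(1), of "\<lambda>q. ?A (y + p *\<^sub>R a + q *\<^sub>R b)"
        "\<lambda>q. frechet_derivative ?A (at (y + p *\<^sub>R a + q *\<^sub>R b)) b"] line2 by auto
  have "\<phi> (y + h *\<^sub>R a + h *\<^sub>R b) - \<phi> (y + h *\<^sub>R a) - \<phi> (y + h *\<^sub>R b) + \<phi> y = ?F h - ?F 0"
    by (simp add: add_ac)
  also have "\<dots> = h * (h * frechet_derivative ?A (at (y + p *\<^sub>R a + q *\<^sub>R b)) b)"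
    unfolding p(3) q(3)[symmetric] by (simp add: add_ac)
  finally show ?thesis
    using p q that[of p q] by (simp add: mult.assoc)
qed

lemma second_derivative_symmetric_real:
  fixes \<phi> :: "'a::euclidean_space \<Rightarrow> real"
  assumes "open S" "Ck_on 2 S \<phi>" "y \<in> S"
  shows "frechet_derivative (\<lambda>x. frechet_derivative \<phi> (at x) a) (at y) b =
    frechet_derivative (\<lambda>x. frechet_derivative \<phi> (at x) b) (at y) a"
    (is "?P y = ?Q y")
proof (rule ccontr)
  assume ne: "?P y \<noteq> ?Q y"
  have "continuous_on S ?P" "continuous_on S ?Q"
    using assms(2) by (simp_all add: numeral_2_eq_2)
  then have "isCont ?P y" "isCont ?Q y"
    using assms by (simp_all add: continuous_on_eq_continuous_at)
  moreover define e where "e = \<bar>?P y - ?Q y\<bar> / 2"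
  moreover have e: "e > 0" using ne e_def by simp
  ultimately obtain r1 r2 where r: "r1 > 0" "r2 > 0"
      "\<And>x. dist x y < r1 \<Longrightarrow> dist (?P x) (?P y) < e"
      "\<And>x. dist x y < r2 \<Longrightarrow> dist (?Q x) (?Q y) < e"
    unfolding continuous_at_eps_delta by metis
  obtain r3 where r3: "r3 > 0" "ball y r3 \<subseteq> S"
    using assms openE by blast
  define r where "r = min (min r1 r2) r3"
  have rpos: "r > 0" using r r3 by (simp add: r_def)
  \<comment> \<open>small enough for the parallelogram with sides \<open>h a\<close>, \<open>h b\<close> to lie in the ball of radius \<open>r\<close>\<close>
  define h where "h = r / (2 * (norm a + norm b + 1))"
  have den: "norm a + norm b + 1 > 0" by (simp add: add_nonneg_pos)
  have h: "h > 0" using rpos den by (simp add: h_def)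
  have bound: "dist (y + p *\<^sub>R a + q *\<^sub>R b) y < r" if "0 \<le> p" "p \<le> h" "0 \<le> q" "q \<le> h" for p q
  proof -
    have "dist (y + p *\<^sub>R a + q *\<^sub>R b) y = norm (p *\<^sub>R a + q *\<^sub>R b)"
      by (simp add: dist_norm algebra_simps)
    also have "\<dots> \<le> p * norm a + q * norm b"
      using norm_triangle_ineq[of "p *\<^sub>R a" "q *\<^sub>R b"] that by simp
    also have "\<dots> \<le> h * norm a + h * norm b"
      using that by (intro add_mono mult_right_mono) auto
    also have "\<dots> \<le> h * (norm a + norm b + 1)" using h by (simp add: algebra_simps)
    also have "\<dots> = r / 2" using den by (simp add: h_def field_simps)
    finally show ?thesis using rpos by simp
  qed
  then have inS: "y + p *\<^sub>R a + q *\<^sub>R b \<in> S" if "0 \<le> p" "p \<le> h" "0 \<le> q" "q \<le> h" for p q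
    using r3 that by (force simp: r_def dist_commute)
  obtain p q where 1: "0 < p" "p < h" "0 < q" "q < h"
    "\<phi> (y + h *\<^sub>R a + h *\<^sub>R b) - \<phi> (y + h *\<^sub>R a) - \<phi> (y + h *\<^sub>R b) + \<phi> y =
     h * h * ?P (y + p *\<^sub>R a + q *\<^sub>R b)"
    using second_difference_mean_value[OF h inS assms(2)] by blast
  have inS': "y + p *\<^sub>R b + q *\<^sub>R a \<in> S" if "0 \<le> p" "p \<le> h" "0 \<le> q" "q \<le> h" for p q
    using inS[of q p] that by (simp add: algebra_simps)
  obtain p' q' where 2: "0 < p'" "p' < h" "0 < q'" "q' < h"
    "\<phi> (y + h *\<^sub>R b + h *\<^sub>R a) - \<phi> (y + h *\<^sub>R b) - \<phi> (y + h *\<^sub>R a) + \<phi> y =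
     h * h * ?Q (y + p' *\<^sub>R b + q' *\<^sub>R a)"
    using second_difference_mean_value[OF h inS' assms(2)] by blast
  have "?P (y + p *\<^sub>R a + q *\<^sub>R b) = ?Q (y + q' *\<^sub>R a + p' *\<^sub>R b)"
  proof -
    have eq: "y + h *\<^sub>R b + h *\<^sub>R a = y + h *\<^sub>R a + h *\<^sub>R b"
        "y + p' *\<^sub>R b + q' *\<^sub>R a = y + q' *\<^sub>R a + p' *\<^sub>R b"
      by (simp_all add: add_ac)
    have "h * h * ?P (y + p *\<^sub>R a + q *\<^sub>R b) = h * h * ?Q (y + q' *\<^sub>R a + p' *\<^sub>R b)"
      using 1(5) 2(5) unfolding eq by linarith
    then show ?thesis using h by simp
  qed
  moreover have "dist (?P (y + p *\<^sub>R a + q *\<^sub>R b)) (?P y) < e"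
    using r(3) bound[of p q] 1 by (simp add: r_def)
  moreover have "dist (?Q (y + q' *\<^sub>R a + p' *\<^sub>R b)) (?Q y) < e"
    using r(4) bound[of q' p'] 2 by (simp add: r_def)
  ultimately have "dist (?P y) (?Q y) < 2 * e"
    using dist_triangle3[of "?P y" "?Q y" "?P (y + p *\<^sub>R a + q *\<^sub>R b)"] by simp
  then show False by (simp add: e_def dist_real_def)
qed

lemma second_derivative_symmetric:
  fixes \<phi> :: "'a::euclidean_space \<Rightarrow> 'b::euclidean_space"
  assumes "open S" "Ck_on 2 S \<phi>" "y \<in> S"
  shows "frechet_derivative (\<lambda>x. frechet_derivative \<phi> (at x) a) (at y) b =
    frechet_derivative (\<lambda>x. frechet_derivative \<phi> (at x) b) (at y) a"
proof (rule euclidean_eqI)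
  fix i :: 'b
  let ?\<psi> = "\<lambda>x. \<phi> x \<bullet> i"
  have comp: "frechet_derivative (\<lambda>x. g x \<bullet> i) (at x) v = frechet_derivative g (at x) v \<bullet> i"
    if "g differentiable at x" for g :: "'a \<Rightarrow> 'b" and x v
    using frechet_derivative_at[OF has_derivative_inner_left[OF that[unfolded frechet_derivative_works]],
        of i, symmetric] by simp
  have d: "\<phi> differentiable at x" "(\<lambda>x. frechet_derivative \<phi> (at x) v) differentiable at x"
    if "x \<in> S" for x v
    using assms(2) that by (simp_all add: numeral_2_eq_2)
  have *: "frechet_derivative (\<lambda>x. frechet_derivative ?\<psi> (at x) v) (at y) u =
      frechet_derivative (\<lambda>x. frechet_derivative \<phi> (at x) v) (at y) u \<bullet> i" for u v
  proof -
    have "frechet_derivative (\<lambda>x. frechet_derivative \<phi> (at x) v \<bullet> i) (at y) =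
        frechet_derivative (\<lambda>x. frechet_derivative ?\<psi> (at x) v) (at y)"
      using assms(1,3) d comp
      by (intro frechet_derivative_transform_within_open[of _ _ S]) (auto intro: differentiable_inner)
    then show ?thesis using comp[OF d(2)[OF assms(3)], of v u] by simp
  qed
  have "Ck_on 2 S ?\<psi>"
    using Ck_on_bounded_linear[OF bounded_linear_inner_left assms(1,2)] .
  from second_derivative_symmetric_real[OF assms(1) this assms(3)]
  show "frechet_derivative (\<lambda>x. frechet_derivative \<phi> (at x) a) (at y) b \<bullet> i =
    frechet_derivative (\<lambda>x. frechet_derivative \<phi> (at x) b) (at y) a \<bullet> i"
    by (simp add: *)
qed

section \<open>Charts and directional derivatives\<close>

lemma smooth_on_differentiable: "smooth_on S f \<Longrightarrow> x \<in> S \<Longrightarrow> f differentiable at x"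
  unfolding smooth_on_def by (metis Ck_on.simps(2))

lemma
  assumes "smooth_atlas A" "c \<in> A"
  shows open_chart_domain: "open (fst c)"
    and chart_inv_chart: "p \<in> fst c \<Longrightarrow> chart_inv c (snd c p) = p"
proof -
  have "open (fst c)" and hom: "homeomorphism (fst c) (snd c ` fst c) (snd c) (chart_inv c)"
    using assms unfolding smooth_atlas_def by auto
  then show "open (fst c)" by blast
  show "p \<in> fst c \<Longrightarrow> chart_inv c (snd c p) = p"
    using hom unfolding homeomorphism_def by auto
qed

lemma open_chart_image:
  assumes "smooth_atlas A" "c \<in> A" "open U"
  shows "open (snd c ` (U \<inter> fst c))"
proof -
  have "homeomorphism (fst c) (snd c ` fst c) (snd c) (chart_inv c)" "open (snd c ` fst c)"
    using assms unfolding smooth_atlas_def by auto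
  moreover have "openin (top_of_set (fst c)) (U \<inter> fst c)"
    using assms(3) by (metis Int_commute openin_open)
  ultimately show ?thesis
    using homeomorphism_imp_open_map openin_open_trans by blast
qed

lemma charts_at_someI:
  assumes "smooth_atlas A"
  shows "(SOME c. c \<in> charts_at A x) \<in> charts_at A x"
proof -
  have "x \<in> (\<Union>c\<in>A. fst c)" using assms unfolding smooth_atlas_def by simp
  then obtain c where "c \<in> charts_at A x" unfolding charts_at_def by blast
  then show ?thesis by (rule someI)
qed

lemma smooth_map_subset: "smooth_map A U \<sigma> \<Longrightarrow> V \<subseteq> U \<Longrightarrow> smooth_map A V \<sigma>"
  unfolding smooth_map_def smooth_on_def
  using Ck_on_subset[OF image_mono[OF Int_mono[OF _ subset_refl]]] by blast

lemma smooth_map_differentiable: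
  assumes "smooth_map A U \<sigma>" "p \<in> U" "c \<in> charts_at A p"
  shows "(\<sigma> \<circ> chart_inv c) differentiable at (snd c p)"
  using assms smooth_on_differentiable[of "snd c ` (U \<inter> fst c)" "\<sigma> \<circ> chart_inv c" "snd c p"]
  unfolding smooth_map_def charts_at_def by blast

lemma smooth_map_chart:
  assumes "smooth_atlas A" "d \<in> A"
  shows "smooth_map A (fst d) (snd d)"
  using assms unfolding smooth_atlas_def smooth_map_def by (simp add: Int_commute)

lemma smooth_map_bilinear:
  assumes "bounded_bilinear \<beta>" "smooth_atlas A" "open U" "smooth_map A U \<sigma>" "smooth_map A U \<tau>"
  shows "smooth_map A U (\<lambda>p. \<beta> (\<sigma> p) (\<tau> p))"
  using assms Ck_on_bilinear[OF assms(1) open_chart_image[OF assms(2)]]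
  unfolding smooth_map_def smooth_on_def o_def by blast

lemma smooth_map_bounded_linear:
  assumes "bounded_linear h" "smooth_atlas A" "open U" "smooth_map A U \<sigma>"
  shows "smooth_map A U (\<lambda>p. h (\<sigma> p))"
  using assms Ck_on_bounded_linear[OF assms(1) open_chart_image[OF assms(2)]]
  unfolding smooth_map_def smooth_on_def o_def by blast

lemma smooth_map_add:
  assumes "smooth_atlas A" "open U" "smooth_map A U \<sigma>" "smooth_map A U \<tau>"
  shows "smooth_map A U (\<lambda>p. \<sigma> p + \<tau> p)"
  using assms Ck_on_add[OF open_chart_image[OF assms(1)]]
  unfolding smooth_map_def smooth_on_def o_def by blast

lemma smooth_map_const: "smooth_map A U (\<lambda>p. k)"
  unfolding smooth_map_def smooth_on_def o_def by (simp add: Ck_on_const)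

text \<open>The chain rule for a change of coordinates.\<close>

lemma frechet_derivative_chart_change:
  assumes "smooth_atlas A" "open U" "smooth_map A U \<sigma>" "p \<in> U" "c \<in> charts_at A p" "d \<in> charts_at A p"
  shows "frechet_derivative (\<sigma> \<circ> chart_inv c) (at (snd c p)) v =
    frechet_derivative (\<sigma> \<circ> chart_inv d) (at (snd d p))
      (frechet_derivative (snd d \<circ> chart_inv c) (at (snd c p)) v)"
proof -
  have c: "c \<in> A" "p \<in> fst c" and d: "d \<in> A" "p \<in> fst d"
    using assms(5,6) by (auto simp: charts_at_def)
  let ?S = "snd c ` (fst d \<inter> fst c)"
  have cp: "chart_inv c (snd c p) = p" using chart_inv_chart assms(1) c by blast
  have dt: "(snd d \<circ> chart_inv c) differentiable at (snd c p)"
    using smooth_map_differentiable[OF smooth_map_chart[OF assms(1) d(1)] d(2) assms(5)] .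
  have ds: "(\<sigma> \<circ> chart_inv d) differentiable at ((snd d \<circ> chart_inv c) (snd c p))"
    using smooth_map_differentiable[OF assms(3,4,6)] cp by simp
  have eq: "((\<sigma> \<circ> chart_inv d) \<circ> (snd d \<circ> chart_inv c)) y = (\<sigma> \<circ> chart_inv c) y" if y: "y \<in> ?S" for y
  proof -
    obtain q where "q \<in> fst d" "q \<in> fst c" "y = snd c q" using y by blast
    then show ?thesis
      using chart_inv_chart[OF assms(1) c(1), of q] chart_inv_chart[OF assms(1) d(1), of q] by simp
  qed
  have "frechet_derivative ((\<sigma> \<circ> chart_inv d) \<circ> (snd d \<circ> chart_inv c)) (at (snd c p)) =
      frechet_derivative (\<sigma> \<circ> chart_inv c) (at (snd c p))"
  proof (rule frechet_derivative_transform_within_open[OF differentiable_chain_at[OF dt ds] _ _ eq])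
    show "open ?S" by (rule open_chart_image[OF assms(1) c(1) open_chart_domain[OF assms(1) d(1)]])
    show "snd c p \<in> ?S" using c(2) d(2) by blast
  qed
  then show ?thesis
    using frechet_derivative_compose[OF dt ds] cp by (metis o_apply)
qed

lemma coord_field_tangent:
  assumes "smooth_atlas A" "c \<in> charts_at A p"
  shows "coord_field A c v p \<in> tangent_space A p"
proof -
  have "frechet_derivative (snd e \<circ> chart_inv c) (at (snd c p)) v =
      frechet_derivative (snd e \<circ> chart_inv d) (at (snd d p))
        (frechet_derivative (snd d \<circ> chart_inv c) (at (snd c p)) v)"
    if d: "d \<in> charts_at A p" and e: "e \<in> charts_at A p" for d e
  proof -
    have e': "e \<in> A" "p \<in> fst e" using e by (auto simp: charts_at_def)
    show ?thesis
      by (rule frechet_derivative_chart_change[OF assms(1) open_chart_domain[OF assms(1) e'(1)]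
            smooth_map_chart[OF assms(1) e'(1)] e'(2) assms(2) d])
  qed
  then have *: "\<forall>d\<in>charts_at A p. \<forall>e\<in>charts_at A p. frechet_derivative (snd e \<circ> chart_inv c) (at (snd c p)) v =
      frechet_derivative (snd e \<circ> chart_inv d) (at (snd d p))
        (frechet_derivative (snd d \<circ> chart_inv c) (at (snd c p)) v)" by blast
  show ?thesis by (simp add: tangent_space_def coord_field_def) (rule *)
qed

lemma tangent_space_chart_change:
  assumes "X \<in> tangent_space A p" "c \<in> charts_at A p" "d \<in> charts_at A p"
  shows "X d = frechet_derivative (snd d \<circ> chart_inv c) (at (snd c p)) (X c)"
  using assms unfolding tangent_space_def by blast

lemma tangent_space_outside: "X \<in> tangent_space A p \<Longrightarrow> c \<notin> charts_at A p \<Longrightarrow> X c = 0"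
  unfolding tangent_space_def by blast

lemma coord_field_eq:
  assumes "Y \<in> tangent_space A p" "c \<in> charts_at A p"
  shows "coord_field A c (Y c) p = Y"
proof
  fix d
  show "coord_field A c (Y c) p d = Y d"
    unfolding coord_field_def
    using tangent_space_chart_change[OF assms, of d, symmetric] tangent_space_outside[OF assms(1), of d]
    by (cases "d \<in> charts_at A p") simp_all
qed

text \<open>Directional derivatives may be computed in any chart at the point.\<close>

lemma dirderiv_coord_field:
  assumes "smooth_atlas A" "open U" "smooth_map A U \<sigma>" "p \<in> U" "c \<in> charts_at A p"
  shows "dirderiv A p (coord_field A c v p) \<sigma> = frechet_derivative (\<sigma> \<circ> chart_inv c) (at (snd c p)) v"
  using frechet_derivative_chart_change[OF assms charts_at_someI[OF assms(1)]] charts_at_someI[OF assms(1)]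
  by (simp add: dirderiv_def coord_field_def Let_def)

lemma tangent_space_scale:
  assumes "smooth_atlas A" "Z \<in> tangent_space A p"
  shows "(\<lambda>c. r *\<^sub>R Z c) \<in> tangent_space A p"
proof -
  have *: "frechet_derivative (snd d \<circ> chart_inv c) (at (snd c p)) (r *\<^sub>R Z c) = r *\<^sub>R Z d"
    if c: "c \<in> charts_at A p" and d: "d \<in> charts_at A p" for c d
  proof -
    have "d \<in> A" "p \<in> fst d" using d by (simp_all add: charts_at_def)
    then have "linear (frechet_derivative (snd d \<circ> chart_inv c) (at (snd c p)))"
      using smooth_map_differentiable[OF smooth_map_chart[OF assms(1)] _ c] linear_frechet_derivative by blast
    from linear_scale[OF this] show ?thesis
      unfolding tangent_space_chart_change[OF assms(2) c d] .
  qed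
  show ?thesis
    unfolding tangent_space_def mem_Collect_eq
    by (intro conjI ballI allI impI *[symmetric]) (simp_all add: tangent_space_outside[OF assms(2)])
qed

lemma rank1_tangent_subbundleD:
  assumes "smooth_atlas A" "rank1_tangent_subbundle A D"
  shows "D p \<subseteq> tangent_space A p" "\<exists>Z\<in>D p. Z \<noteq> (\<lambda>c. 0)"
proof -
  obtain U Z where UZ: "p \<in> U" "smooth_vector_field A U Z"
      "\<forall>p\<in>U. Z p \<noteq> (\<lambda>c. 0) \<and> D p = {(\<lambda>c. r *\<^sub>R Z p c) |r. True}"
    using assms(2) unfolding rank1_tangent_subbundle_def by meson
  then have "Z p \<in> tangent_space A p" by (simp add: smooth_vector_field_def)
  then show "D p \<subseteq> tangent_space A p" using UZ tangent_space_scale[OF assms(1)] by auto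
  have "Z p = (\<lambda>c. 1 *\<^sub>R Z p c)" by simp
  then have "Z p \<in> D p" using UZ by blast
  then show "\<exists>Z\<in>D p. Z \<noteq> (\<lambda>c. 0)" using UZ by blast
qed

lemma dirderiv_const [simp]: "dirderiv A x X (\<lambda>p. k) = 0"
  by (simp add: dirderiv_def o_def)

lemma dirderiv_bilinear:
  assumes "bounded_bilinear \<beta>" "smooth_atlas A" "x \<in> U" "smooth_map A U \<sigma>" "smooth_map A U \<tau>"
  shows "dirderiv A x X (\<lambda>p. \<beta> (\<sigma> p) (\<tau> p)) =
    \<beta> (\<sigma> x) (dirderiv A x X \<tau>) + \<beta> (dirderiv A x X \<sigma>) (\<tau> x)"
proof -
  define c where "c = (SOME c. c \<in> charts_at A x)"
  have c: "c \<in> charts_at A x" using charts_at_someI[OF assms(2)] c_def by simp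
  have cx: "chart_inv c (snd c x) = x"
    using c chart_inv_chart[OF assms(2), of c x] by (simp add: charts_at_def)
  have "((\<lambda>y. \<beta> ((\<sigma> \<circ> chart_inv c) y) ((\<tau> \<circ> chart_inv c) y)) has_derivative
      (\<lambda>v. \<beta> ((\<sigma> \<circ> chart_inv c) (snd c x)) (frechet_derivative (\<tau> \<circ> chart_inv c) (at (snd c x)) v) +
       \<beta> (frechet_derivative (\<sigma> \<circ> chart_inv c) (at (snd c x)) v) ((\<tau> \<circ> chart_inv c) (snd c x))))
      (at (snd c x))"
    by (intro bounded_bilinear.FDERIV[OF assms(1)]
        smooth_map_differentiable[OF _ assms(3) c, unfolded frechet_derivative_works] assms(4,5))
  from frechet_derivative_at[OF this, symmetric] show ?thesis
    unfolding dirderiv_def c_def[symmetric] Let_def by (simp add: o_def cx)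
qed

lemma dirderiv_bounded_linear:
  assumes "bounded_linear h" "smooth_atlas A" "x \<in> U" "smooth_map A U \<sigma>"
  shows "dirderiv A x X (\<lambda>p. h (\<sigma> p)) = h (dirderiv A x X \<sigma>)"
proof -
  have "bounded_bilinear (\<lambda>(r::real) y. r *\<^sub>R h y)"
    using bounded_bilinear.comp[OF bounded_bilinear_scaleR bounded_linear_ident assms(1)] .
  from dirderiv_bilinear[OF this assms(2,3) smooth_map_const assms(4), of X 1]
  show ?thesis by simp
qed

lemma dirderiv_add:
  assumes "smooth_atlas A" "x \<in> U" "smooth_map A U \<sigma>" "smooth_map A U \<tau>"
  shows "dirderiv A x X (\<lambda>p. \<sigma> p + \<tau> p) = dirderiv A x X \<sigma> + dirderiv A x X \<tau>"
proof -
  define c where "c = (SOME c. c \<in> charts_at A x)"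
  have c: "c \<in> charts_at A x" using charts_at_someI[OF assms(1)] c_def by simp
  have "((\<lambda>y. (\<sigma> \<circ> chart_inv c) y + (\<tau> \<circ> chart_inv c) y) has_derivative
      (\<lambda>v. frechet_derivative (\<sigma> \<circ> chart_inv c) (at (snd c x)) v +
           frechet_derivative (\<tau> \<circ> chart_inv c) (at (snd c x)) v)) (at (snd c x))"
    by (intro has_derivative_add
        smooth_map_differentiable[OF _ assms(2) c, unfolded frechet_derivative_works] assms(3,4))
  from frechet_derivative_at[OF this, symmetric] show ?thesis
    unfolding dirderiv_def c_def[symmetric] Let_def by (simp add: o_def)
qed

lemma dirderiv_cong:
  assumes "smooth_atlas A" "open U" "x \<in> U" "smooth_map A U \<sigma>" "\<And>p. p \<in> U \<Longrightarrow> \<sigma> p = \<tau> p"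
  shows "dirderiv A x X \<sigma> = dirderiv A x X \<tau>"
proof -
  define c where "c = (SOME c. c \<in> charts_at A x)"
  have c: "c \<in> charts_at A x" "c \<in> A" "x \<in> fst c"
    using charts_at_someI[OF assms(1), of x] by (simp_all add: c_def charts_at_def)
  have "frechet_derivative (\<sigma> \<circ> chart_inv c) (at (snd c x)) = frechet_derivative (\<tau> \<circ> chart_inv c) (at (snd c x))"
  proof (rule frechet_derivative_transform_within_open[OF smooth_map_differentiable[OF assms(4,3) c(1)]
        open_chart_image[OF assms(1) c(2) assms(2)]])
    show "snd c x \<in> snd c ` (U \<inter> fst c)" using assms(3) c(3) by blast
  qed (auto simp: assms(5) chart_inv_chart[OF assms(1) c(2)])
  then show ?thesis unfolding dirderiv_def c_def[symmetric] by (simp add: Let_def)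
qed

lemma has_vector_derivative_along_curve:
  assumes "smooth_atlas A" "integral_curve A D J \<gamma>" "s \<in> J" "open U" "smooth_map A U \<sigma>" "\<gamma> s \<in> U"
  shows "((\<lambda>r. \<sigma> (\<gamma> r)) has_vector_derivative dirderiv A (\<gamma> s) (velocity A \<gamma> s) \<sigma>) (at s)"
proof -
  define c where "c = (SOME c. c \<in> charts_at A (\<gamma> s))"
  have c: "c \<in> charts_at A (\<gamma> s)" "c \<in> A" "\<gamma> s \<in> fst c"
    using charts_at_someI[OF assms(1), of "\<gamma> s"] by (simp_all add: c_def charts_at_def)
  have J: "open J" and cont: "continuous_on J \<gamma>"
    and sm: "smooth_on {s \<in> J. \<gamma> s \<in> fst c} (snd c \<circ> \<gamma>)"
    using assms(2) c(2) unfolding integral_curve_def by auto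
  have "((snd c \<circ> \<gamma>) has_vector_derivative velocity A \<gamma> s c) (at s)"
    using smooth_on_differentiable[OF sm, of s] c assms(3)
    by (simp add: velocity_def vector_derivative_works)
  moreover have "((\<sigma> \<circ> chart_inv c) has_derivative
      frechet_derivative (\<sigma> \<circ> chart_inv c) (at (snd c (\<gamma> s)))) (at ((snd c \<circ> \<gamma>) s))"
    using smooth_map_differentiable[OF assms(5,6) c(1)] by (simp add: frechet_derivative_works)
  ultimately have "((\<sigma> \<circ> chart_inv c \<circ> (snd c \<circ> \<gamma>)) has_vector_derivative
      dirderiv A (\<gamma> s) (velocity A \<gamma> s) \<sigma>) (at s)"
    unfolding dirderiv_def c_def[symmetric] Let_def
    using vector_derivative_diff_chain_within[of "snd c \<circ> \<gamma>" _ s UNIV] has_derivative_at_withinI by metis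
  moreover have "open (J \<inter> \<gamma> -` fst c)"
    using cont J open_chart_domain[OF assms(1) c(2)] by (simp add: continuous_on_open_vimage Int_commute)
  ultimately show ?thesis
  proof (rule has_vector_derivative_transform_within_open)
    show "s \<in> J \<inter> \<gamma> -` fst c" using assms(3) c(3) by simp
    show "(\<sigma> \<circ> chart_inv c \<circ> (snd c \<circ> \<gamma>)) r = \<sigma> (\<gamma> r)" if "r \<in> J \<inter> \<gamma> -` fst c" for r
      using that chart_inv_chart[OF assms(1) c(2), of "\<gamma> r"] by simp
  qed
qed

section \<open>Linear algebra in signature (4,2)\<close>

lemma
  assumes "signature_4_2 B"
  shows signature_bounded_bilinear: "bounded_bilinear B"
    and signature_sym: "B u v = B v u"
  using assms unfolding signature_4_2_def by (auto simp: bilinear_conv_bounded_bilinear)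

lemma signature_basis:
  assumes "signature_4_2 B"
  obtains e :: "nat \<Rightarrow> real^6" and \<epsilon> :: "nat \<Rightarrow> real"
  where "span (e ` {..<6}) = UNIV"
    and "\<And>i j. i < 6 \<Longrightarrow> j < 6 \<Longrightarrow> B (e i) (e j) = (if i = j then \<epsilon> i else 0)"
    and "\<And>i. \<epsilon> i = (if i < 4 then 1 else -1)"
proof -
  obtain e :: "nat \<Rightarrow> real^6" where e: "span (e ` {..<6}) = UNIV"
    "\<forall>i<6. \<forall>j<6. B (e i) (e j) = (if i = j then (if i < 4 then 1 else -1) else 0)"
    using assms unfolding signature_4_2_def by blast
  then show thesis by (intro that[of e "\<lambda>i. if i < 4 then 1 else -1"]) auto
qed

lemma span_image_finite_sum:
  fixes e :: "'i \<Rightarrow> 'b::real_vector"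
  assumes "v \<in> span (e ` I)" "finite I"
  obtains c where "v = (\<Sum>i\<in>I. c i *\<^sub>R e i)"
proof -
  have "subspace (range (\<lambda>c. \<Sum>i\<in>I. c i *\<^sub>R e i))"
  proof (rule subspaceI)
    show "0 \<in> range (\<lambda>c. \<Sum>i\<in>I. c i *\<^sub>R e i)"
      by (rule image_eqI[of _ _ "\<lambda>i. 0"]) auto
  next
    fix x y assume "x \<in> range (\<lambda>c. \<Sum>i\<in>I. c i *\<^sub>R e i)" "y \<in> range (\<lambda>c. \<Sum>i\<in>I. c i *\<^sub>R e i)"
    then obtain c d where "x = (\<Sum>i\<in>I. c i *\<^sub>R e i)" "y = (\<Sum>i\<in>I. d i *\<^sub>R e i)" by auto
    then show "x + y \<in> range (\<lambda>c. \<Sum>i\<in>I. c i *\<^sub>R e i)"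
      by (intro image_eqI[of _ _ "\<lambda>i. c i + d i"]) (auto simp: scaleR_left_distrib sum.distrib)
  next
    fix r x assume "x \<in> range (\<lambda>c. \<Sum>i\<in>I. c i *\<^sub>R e i)"
    then obtain c where "x = (\<Sum>i\<in>I. c i *\<^sub>R e i)" by auto
    then show "r *\<^sub>R x \<in> range (\<lambda>c. \<Sum>i\<in>I. c i *\<^sub>R e i)"
      by (intro image_eqI[of _ _ "\<lambda>i. r * c i"]) (auto simp: scaleR_sum_right)
  qed
  moreover have "e ` I \<subseteq> range (\<lambda>c. \<Sum>i\<in>I. c i *\<^sub>R e i)"
  proof
    fix x assume "x \<in> e ` I"
    then obtain j where "j \<in> I" "x = e j" by auto
    then show "x \<in> range (\<lambda>c. \<Sum>i\<in>I. c i *\<^sub>R e i)"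
      using assms(2)
      by (intro image_eqI[of _ _ "\<lambda>i. if i = j then 1 else 0"]) (auto simp: if_distrib[of "\<lambda>r. r *\<^sub>R _"] cong: if_cong)
  qed
  ultimately have "span (e ` I) \<subseteq> range (\<lambda>c. \<Sum>i\<in>I. c i *\<^sub>R e i)" by (rule span_minimal[rotated])
  then show thesis using assms(1) that by blast
qed

text \<open>The sign of \<open>r\<close> selects the semidefiniteness. The form \<open>r B\<close> is positive definite on the span
  of the \<open>e i\<close> with \<open>i \<in> I\<close>, so this span meets \<open>W\<close> only in \<open>0\<close>.\<close>

lemma semidefinite_dim_le:
  fixes e :: "nat \<Rightarrow> real^6" and \<epsilon> :: "nat \<Rightarrow> real"
  assumes "bounded_bilinear B" "span (e ` {..<6}) = UNIV" "I \<subseteq> {..<6}" "r \<noteq> 0"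
    and orth: "\<And>i j. i < 6 \<Longrightarrow> j < 6 \<Longrightarrow> B (e i) (e j) = (if i = j then \<epsilon> i else 0)"
    and pos: "\<And>i. i \<in> I \<Longrightarrow> r * \<epsilon> i > 0" and nz: "\<And>i. \<epsilon> i \<noteq> 0"
    and W: "subspace W" "\<And>v. v \<in> W \<Longrightarrow> r * B v v \<le> 0"
  shows "dim W + card I \<le> 6"
proof -
  interpret B: bounded_bilinear B by fact
  have inj: "inj_on e {..<6}"
    using orth nz by (intro inj_onI) (metis lessThan_iff)
  have "independent (e ` {..<6})"
  proof (rule card_le_dim_spanning[of _ UNIV])
    show "card (e ` {..<6}) \<le> dim (UNIV :: (real^6) set)"
      using card_image[OF inj] by simp
  qed (use assms(2) in auto)
  then have "independent (e ` I)" using assms(3) independent_mono by blast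
  then have dimI: "dim (span (e ` I)) = card I"
    using dim_eq_card_independent[of "e ` I"] card_image[OF inj_on_subset[OF inj assms(3)]]
    by (simp add: dim_span)
  have finI: "finite I" using assms(3) finite_subset by blast
  have "W \<inter> span (e ` I) = {0}"
  proof -
    have "v = 0" if v: "v \<in> W" "v \<in> span (e ` I)" for v
    proof -
      obtain c where c: "v = (\<Sum>i\<in>I. c i *\<^sub>R e i)"
        using span_image_finite_sum[OF v(2) finI] .
      have "B v v = (\<Sum>i\<in>I. \<Sum>j\<in>I. c j * (c i * B (e j) (e i)))"
        unfolding c by (simp add: B.sum_left B.sum_right B.scaleR_left B.scaleR_right sum_distrib_left mult.left_commute)
      also have "\<dots> = (\<Sum>i\<in>I. \<Sum>j\<in>I. if j = i then c i * (c i * \<epsilon> i) else 0)"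
        using assms(3) by (intro sum.cong) (auto simp: orth subset_iff)
      also have "\<dots> = (\<Sum>i\<in>I. c i * (c i * \<epsilon> i))" using finI by simp
      finally have "r * B v v = (\<Sum>i\<in>I. (c i)\<^sup>2 * (r * \<epsilon> i))"
        by (simp add: sum_distrib_left power2_eq_square algebra_simps)
      moreover have nn: "\<forall>i\<in>I. 0 \<le> (c i)\<^sup>2 * (r * \<epsilon> i)" using pos by (simp add: less_imp_le)
      ultimately have "(\<Sum>i\<in>I. (c i)\<^sup>2 * (r * \<epsilon> i)) = 0"
        using W(2)[OF v(1)] sum_nonneg[of I "\<lambda>i. (c i)\<^sup>2 * (r * \<epsilon> i)"] by fastforce
      then have z: "\<forall>i\<in>I. (c i)\<^sup>2 * (r * \<epsilon> i) = 0"
        using sum_nonneg_eq_0_iff[OF finI, of "\<lambda>i. (c i)\<^sup>2 * (r * \<epsilon> i)"] nn by blast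
      have "\<forall>i\<in>I. c i = 0"
      proof
        fix i assume "i \<in> I"
        then show "c i = 0" using z pos[of i] by fastforce
      qed
      then show "v = 0" by (simp add: c)
    qed
    then show ?thesis using W(1) subspace_0 span_zero by blast
  qed
  then have "dim (W \<inter> span (e ` I)) = 0" by (metis dim_eq_0 order_refl)
  then have "dim W + card I = dim {x + y |x y. x \<in> W \<and> y \<in> span (e ` I)}"
    using dim_sums_Int[OF W(1) subspace_span, of "e ` I"] dimI by linarith
  also have "\<dots> \<le> 6" using dim_subset_UNIV[where 'a = "real^6"] by simp
  finally show ?thesis .
qed

lemma
  assumes "signature_4_2 B" "subspace W"
  shows dim_nonpos_le: "(\<And>v. v \<in> W \<Longrightarrow> B v v \<le> 0) \<Longrightarrow> dim W \<le> 2"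
    and dim_nonneg_le: "(\<And>v. v \<in> W \<Longrightarrow> B v v \<ge> 0) \<Longrightarrow> dim W \<le> 4"
proof -
  obtain e :: "nat \<Rightarrow> real^6" and \<epsilon> where e: "span (e ` {..<6}) = UNIV"
    "\<And>i j. i < 6 \<Longrightarrow> j < 6 \<Longrightarrow> B (e i) (e j) = (if i = j then \<epsilon> i else 0)"
    "\<And>i. \<epsilon> i = (if i < 4 then 1 else -1)"
    using signature_basis[OF assms(1)] by blast
  note le = semidefinite_dim_le[OF signature_bounded_bilinear[OF assms(1)] e(1) _ _ e(2)]
  have sub: "{..<4} \<subseteq> {..<6::nat}" "{4..<6} \<subseteq> {..<6::nat}" by auto
  show "dim W \<le> 2" if "\<And>v. v \<in> W \<Longrightarrow> B v v \<le> 0"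
    using le[OF sub(1), of 1 W] that assms(2) e(3) by simp
  show "dim W \<le> 4" if "\<And>v. v \<in> W \<Longrightarrow> B v v \<ge> 0"
    using le[OF sub(2), of "-1" W] that assms(2) e(3) by simp
qed

text \<open>Otherwise \<open>V\<close> and \<open>u\<close> would span a negative semidefinite subspace of dimension three.\<close>

lemma perp_isotropic_pos:
  assumes "signature_4_2 B" "subspace V" "dim V = 2" "\<And>a b. a \<in> V \<Longrightarrow> b \<in> V \<Longrightarrow> B a b = 0"
    and "u \<in> perp B V" "u \<notin> V"
  shows "B u u > 0"
proof (rule ccontr)
  assume neg: "\<not> B u u > 0"
  interpret B: bounded_bilinear B using signature_bounded_bilinear[OF assms(1)] .
  have "B w w \<le> 0" if w: "w \<in> span (insert u V)" for w
  proof -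
    obtain k where k: "w - k *\<^sub>R u \<in> V"
      using w assms(2) by (auto simp: span_breakdown_eq span_eq_iff[THEN iffD2])
    define v where "v = w - k *\<^sub>R u"
    have v: "v \<in> V" and w: "w = k *\<^sub>R u + v" using k by (auto simp: v_def)
    have "B u v = 0" "B v u = 0" using assms(5) v signature_sym[OF assms(1)] by (auto simp: perp_def)
    then have "B w w = k\<^sup>2 * B u u"
      using assms(4)[OF v v]
      by (simp add: w B.add_left B.add_right B.scaleR_left B.scaleR_right power2_eq_square)
    then show ?thesis using neg by (simp add: mult_nonneg_nonpos)
  qed
  then have "dim (span (insert u V)) \<le> 2"
    by (intro dim_nonpos_le[OF assms(1)]) auto
  then show False
    using assms(2,3,6) by (simp add: dim_insert span_eq_iff[THEN iffD2])
qed

text \<open>The quotient \<open>V\<^sup>\<bottom>/V\<close> is a Euclidean plane: for orthogonal non-zero \<open>u, y\<close> in it, the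
  orthogonal complement of \<open>u\<close> is the line through \<open>y\<close>.\<close>

lemma perp_isotropic_plane:
  assumes sig: "signature_4_2 B" and V: "subspace V" "dim V = 2"
    and iso: "\<And>a b. a \<in> V \<Longrightarrow> b \<in> V \<Longrightarrow> B a b = 0"
    and u: "u \<in> perp B V" "u \<notin> V" and y: "y \<in> perp B V" "y \<notin> V"
    and w: "w \<in> perp B V" and orth: "B u y = 0" "B w u = 0"
  obtains k where "w - k *\<^sub>R y \<in> V"
proof (rule ccontr)
  assume notin: "\<not> thesis"
  note plane = that
  interpret B: bounded_bilinear B using signature_bounded_bilinear[OF sig] .
  note sym = signature_sym[OF sig]
  \<comment> \<open>the component \<open>x\<close> of \<open>w\<close> orthogonal to \<open>y\<close>: if it were not in \<open>V\<close>, then \<open>V\<close>, \<open>u\<close>, \<open>y\<close>, \<open>x\<close> would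
    span a positive semidefinite subspace of dimension five\<close>
  define k where "k = B w y / B y y"
  define x where "x = w - k *\<^sub>R y"
  have uu: "B u u > 0" and yy: "B y y > 0"
    using perp_isotropic_pos[OF sig V iso] u y by auto
  have "x \<notin> V" using notin plane x_def by blast
  moreover have xp: "x \<in> perp B V"
    using w y unfolding x_def perp_def by (simp add: B.diff_left B.scaleR_left)
  ultimately have xx: "B x x > 0" using perp_isotropic_pos[OF sig V iso] by blast
  have xu: "B x u = 0" and xy: "B x y = 0"
    using orth yy sym[of u y] by (auto simp: x_def k_def B.diff_left B.scaleR_left)
  have V': "span V = V" using V by (simp add: span_eq_iff)
  have pv: "B u v = 0" "B y v = 0" "B x v = 0" "B v u = 0" "B v y = 0" "B v x = 0" if "v \<in> V" for v
    using u y xp that sym by (auto simp: perp_def)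
  have orth': "B y u = 0" "B u x = 0" "B y x = 0" using orth xu xy sym by metis+
  have dec: "\<exists>a v. v \<in> V \<and> z = a *\<^sub>R u + v" if "z \<in> span (insert u V)" for z
    using that unfolding span_breakdown_eq V' by (metis add.commute diff_add_cancel)
  have dec2: "\<exists>b a v. v \<in> V \<and> z = b *\<^sub>R y + a *\<^sub>R u + v" if z: "z \<in> span (insert y (insert u V))" for z
  proof -
    obtain b where "z - b *\<^sub>R y \<in> span (insert u V)" using z unfolding span_breakdown_eq by blast
    from dec[OF this] obtain a v where "v \<in> V" "z - b *\<^sub>R y = a *\<^sub>R u + v" by blast
    then have "v \<in> V \<and> z = b *\<^sub>R y + a *\<^sub>R u + v" by (simp add: diff_eq_eq add_ac)
    then show ?thesis by blast
  qed
  have dec3: "\<exists>c b a v. v \<in> V \<and> z = c *\<^sub>R x + b *\<^sub>R y + a *\<^sub>R u + v"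
    if z: "z \<in> span (insert x (insert y (insert u V)))" for z
  proof -
    obtain c where "z - c *\<^sub>R x \<in> span (insert y (insert u V))" using z unfolding span_breakdown_eq by blast
    from dec2[OF this] obtain b a v where "v \<in> V" "z - c *\<^sub>R x = b *\<^sub>R y + a *\<^sub>R u + v" by blast
    then have "v \<in> V \<and> z = c *\<^sub>R x + b *\<^sub>R y + a *\<^sub>R u + v" by (simp add: diff_eq_eq add_ac)
    then show ?thesis by blast
  qed
  have y': "y \<notin> span (insert u V)"
  proof
    assume "y \<in> span (insert u V)"
    then obtain a v where "v \<in> V" "y = a *\<^sub>R u + v" using dec by blast
    then have "B y y = B y (a *\<^sub>R u + v)" "v \<in> V" by auto
    then have "B y y = 0" using pv orth' by (simp add: B.add_right B.scaleR_right)
    then show False using yy by simp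
  qed
  have x': "x \<notin> span (insert y (insert u V))"
  proof
    assume "x \<in> span (insert y (insert u V))"
    then obtain b a v where "v \<in> V" "x = b *\<^sub>R y + a *\<^sub>R u + v" using dec2 by blast
    then have "B x x = B x (b *\<^sub>R y + a *\<^sub>R u + v)" "v \<in> V" by auto
    then have "B x x = 0" using pv xu xy by (simp add: B.add_right B.scaleR_right)
    then show False using xx by simp
  qed
  have "dim (span (insert x (insert y (insert u V)))) \<le> 4"
  proof (rule dim_nonneg_le[OF sig subspace_span])
    fix z assume "z \<in> span (insert x (insert y (insert u V)))"
    then obtain c b a v where v: "v \<in> V" and z: "z = c *\<^sub>R x + b *\<^sub>R y + a *\<^sub>R u + v" using dec3 by blast
    have "B z z = c\<^sup>2 * B x x + b\<^sup>2 * B y y + a\<^sup>2 * B u u"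
      using pv[OF v] iso[OF v v] orth orth' xu xy
      by (simp add: z B.add_left B.add_right B.scaleR_left B.scaleR_right power2_eq_square)
    then show "B z z \<ge> 0" using xx yy uu by simp
  qed
  then show False using x' y' u(2) V(2) by (simp add: dim_insert V')
qed

text \<open>The inverse of an orthogonal transformation is its adjoint, which depends linearly on the
  transformation. Inverses of smooth families of orthogonal transformations are therefore smooth.\<close>

lemma orthogonal_group_inverse:
  assumes "signature_4_2 B"
  obtains K :: "real^6^6 \<Rightarrow> real^6^6" where "bounded_linear K"
    and "\<And>M. M \<in> orthogonal_group B \<Longrightarrow> K M = matrix_inv M"
    and "\<And>M. M \<in> orthogonal_group B \<Longrightarrow> K M ** M = mat 1 \<and> M ** K M = mat 1"
proof -
  obtain e :: "nat \<Rightarrow> real^6" and \<epsilon> :: "nat \<Rightarrow> real" where e: "span (e ` {..<6}) = UNIV"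
    "\<And>i j. i < 6 \<Longrightarrow> j < 6 \<Longrightarrow> B (e i) (e j) = (if i = j then \<epsilon> i else 0)"
    "\<And>i. \<epsilon> i = (if i < 4 then 1 else -1)"
    using signature_basis[OF assms(1)] by blast
  interpret B: bounded_bilinear B using signature_bounded_bilinear[OF assms(1)] .
  define h where "h = (\<lambda>M v. \<Sum>i<6. (\<epsilon> i * B (M *v e i) v) *\<^sub>R e i)"
  define K where "K = (\<lambda>M :: real^6^6. matrix (h M) :: real^6^6)"
  have lin: "linear (h M)" for M
    unfolding h_def
    by (intro linearI) (simp_all add: B.add_right B.scaleR_right distrib_left scaleR_left_distrib
        sum.distrib scaleR_sum_right mult.left_commute)
  have "linear K"
  proof (rule linearI)
    show "K (M + N) = K M + K N" for M N
      unfolding K_def h_def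
      by (simp add: vec_eq_iff matrix_def matrix_vector_mult_add_rdistrib B.add_left distrib_left
          scaleR_left_distrib sum.distrib distrib_right)
    show "K (r *\<^sub>R M) = r *\<^sub>R K M" for r M
      unfolding K_def h_def
      by (simp add: vec_eq_iff matrix_def scaleR_matrix_vector_assoc[symmetric] B.scaleR_left
          sum_distrib_left algebra_simps)
  qed
  moreover have inv: "K M ** M = mat 1" if M: "M \<in> orthogonal_group B" for M
  proof -
    have "(K M ** M) *v u = mat 1 *v u" for u
    proof -
      obtain c where c: "u = (\<Sum>j<6. c j *\<^sub>R e j)"
        using span_image_finite_sum[of u e "{..<6}"] e(1) by auto
      have "\<epsilon> i * B (e i) u = c i" if "i < 6" for i
      proof -
        have "B (e i) u = (\<Sum>j<6. if j = i then c i * \<epsilon> i else 0)"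
          unfolding c B.sum_right using that by (intro sum.cong) (auto simp: B.scaleR_right e(2))
        then show ?thesis using that by (simp add: e(3))
      qed
      then have "h M (M *v u) = u"
        using M unfolding h_def orthogonal_group_def by (simp add: c)
      then show ?thesis
        unfolding matrix_vector_mul_assoc[symmetric] K_def
        using fun_cong[OF matrix_vector_mul(2)[OF lin[of M]], of "M *v u"] by simp
    qed
    then show ?thesis by (simp add: matrix_eq)
  qed
  moreover have "M ** K M = mat 1" if "M \<in> orthogonal_group B" for M
    using inv[OF that] matrix_left_right_inverse by blast
  moreover have "K M = matrix_inv M" if "M \<in> orthogonal_group B" for M
  proof -
    have "M ** K M = mat 1 \<and> K M ** M = mat 1" using calculation(2,3)[OF that] by simp
    then have "M ** matrix_inv M = mat 1" unfolding matrix_inv_def by (rule someI2) simp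
    then have "K M ** (M ** matrix_inv M) = K M" by simp
    then show ?thesis using inv[OF that] by (simp add: matrix_mul_assoc)
  qed
  ultimately show thesis by (intro that[of K]) (auto simp: linear_conv_bounded_linear)
qed

section \<open>Legendre maps\<close>

lemma subbundle_frame:
  fixes F :: "'a::topological_space \<Rightarrow> (real^6) set"
  assumes "subbundle A k F"
  obtains U e where "open U" "x \<in> U" "\<And>j. j < k \<Longrightarrow> smooth_map A U (e j)"
    "\<And>p. p \<in> U \<Longrightarrow> F p = span ((\<lambda>j::nat. e j p) ` {..<k})" "\<And>p. p \<in> U \<Longrightarrow> dim (F p) = k"
proof -
  have "\<exists>U e. open U \<and> x \<in> U \<and> (\<forall>j<k. smooth_map A U (e j)) \<and>
     (\<forall>p\<in>U. F p = span ((\<lambda>j::nat. e j p) ` {..<k}) \<and> dim (F p) = k)"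
    using assms unfolding subbundle_def by (rule spec)
  then obtain U and e :: "nat \<Rightarrow> 'a \<Rightarrow> real^6" where *: "open U \<and> x \<in> U \<and> (\<forall>j<k. smooth_map A U (e j)) \<and>
     (\<forall>p\<in>U. F p = span ((\<lambda>j::nat. e j p) ` {..<k}) \<and> dim (F p) = k)"
    by (elim exE) (rule that)
  show thesis by (rule that[of U e]) (use * in blast)+
qed

lemma subbundle_fibre:
  assumes "subbundle A k F"
  shows "subspace (F x)" "dim (F x) = k"
proof -
  have "subspace (F x) \<and> dim (F x) = k"
    by (rule subbundle_frame[OF assms, of x]) (metis subspace_span)
  then show "subspace (F x)" "dim (F x) = k" by simp_all
qed

lemma line_subbundle_frame:
  assumes "subbundle A 1 F"
  obtains U \<sigma> where "local_section A F U \<sigma>" "x \<in> U" "\<And>p. p \<in> U \<Longrightarrow> F p = span {\<sigma> p}"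
    "\<And>p. p \<in> U \<Longrightarrow> \<sigma> p \<noteq> 0"
proof (rule subbundle_frame[OF assms, of x])
  fix U and e :: "nat \<Rightarrow> 'a \<Rightarrow> real^6"
  assume U: "open U" "x \<in> U" "\<And>j. j < 1 \<Longrightarrow> smooth_map A U (e j)"
    and span: "\<And>p. p \<in> U \<Longrightarrow> F p = span ((\<lambda>j. e j p) ` {..<1})" and dim: "\<And>p. p \<in> U \<Longrightarrow> dim (F p) = 1"
  have "{..<1::nat} = {0}" by auto
  then have F: "F p = span {e 0 p}" if "p \<in> U" for p
    using span[OF that] by simp
  have nz: "e 0 p \<noteq> 0" if "p \<in> U" for p
    using dim[OF that] F[OF that] by (cases "e 0 p = 0") simp_all
  have "local_section A F U (e 0)"
    unfolding local_section_def using U F by (simp add: span_base)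
  then show thesis by (rule that[OF _ U(2) F nz])
qed

lemma local_section_subset:
  "local_section A F U \<sigma> \<Longrightarrow> open V \<Longrightarrow> V \<subseteq> U \<Longrightarrow> local_section A F V \<sigma>"
  unfolding local_section_def using smooth_map_subset by blast

lemma
  assumes "legendre_map A B f"
  shows legendre_subspace: "subspace (f x)" and legendre_dim: "dim (f x) = 2"
    and legendre_isotropic: "u \<in> f x \<Longrightarrow> v \<in> f x \<Longrightarrow> B u v = 0"
proof -
  have *: "subbundle A 2 f" "\<forall>x. \<forall>u\<in>f x. \<forall>v\<in>f x. B u v = 0"
    using assms unfolding legendre_map_def by blast+
  show "subspace (f x)" "dim (f x) = 2" by (rule subbundle_fibre[OF *(1)])+
  show "u \<in> f x \<Longrightarrow> v \<in> f x \<Longrightarrow> B u v = 0" using *(2) by blast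
qed

lemma legendre_contact:
  assumes "legendre_map A B f" "local_section A f U \<sigma>" "x \<in> U" "X \<in> tangent_space A x"
  shows "dirderiv A x X \<sigma> \<in> perp B (f x)"
  using assms unfolding legendre_map_def derived_set_def by blast

lemma legendre_immersion:
  assumes "legendre_map A B f" "X \<in> tangent_space A x"
    "\<And>U \<sigma>. local_section A f U \<sigma> \<Longrightarrow> x \<in> U \<Longrightarrow> dirderiv A x X \<sigma> \<in> f x"
  shows "X = (\<lambda>c. 0)"
  using assms unfolding legendre_map_def by blast

text \<open>Differentiating the contact condition \<open>(d\<^sub>a \<sigma>, \<tau>) = 0\<close> in the direction \<open>b\<close>.\<close>

lemma legendre_second_derivative:
  assumes "smooth_atlas A" "signature_4_2 B" "legendre_map A B f"
    and \<sigma>: "local_section A f U \<sigma>" and \<tau>: "local_section A f U \<tau>"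
    and x: "x \<in> U" and c: "c \<in> charts_at A x"
  shows "B (frechet_derivative (\<sigma> \<circ> chart_inv c) (at (snd c x)) a)
      (frechet_derivative (\<tau> \<circ> chart_inv c) (at (snd c x)) b) =
    - B (frechet_derivative (\<lambda>y. frechet_derivative (\<sigma> \<circ> chart_inv c) (at y) a) (at (snd c x)) b) (\<tau> x)"
proof -
  have cA: "c \<in> A" "x \<in> fst c" using c by (auto simp: charts_at_def)
  have U: "open U" and sm: "smooth_map A U \<sigma>" "smooth_map A U \<tau>"
    using \<sigma> \<tau> unfolding local_section_def by auto
  let ?S = "snd c ` (U \<inter> fst c)" and ?y = "snd c x"
  let ?D = "\<lambda>y. frechet_derivative (\<sigma> \<circ> chart_inv c) (at y) a"
  have S: "open ?S" "?y \<in> ?S" using open_chart_image[OF assms(1) cA(1) U] x cA by auto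
  have zero: "B (?D y) ((\<tau> \<circ> chart_inv c) y) = 0" if y: "y \<in> ?S" for y
  proof -
    obtain p where p: "p \<in> U" "p \<in> fst c" "y = snd c p" using y by blast
    then have cp: "c \<in> charts_at A p" using cA by (simp add: charts_at_def)
    have "?D y \<in> perp B (f p)"
      using legendre_contact[OF assms(3) \<sigma> p(1) coord_field_tangent[OF assms(1) cp]]
        dirderiv_coord_field[OF assms(1) U sm(1) p(1) cp] p(3) by metis
    moreover have "\<tau> p \<in> f p" using \<tau> p(1) unfolding local_section_def by blast
    ultimately show ?thesis
      using p chart_inv_chart[OF assms(1) cA(1)] by (simp add: perp_def)
  qed
  have "Ck_on 2 ?S (\<sigma> \<circ> chart_inv c)"
    using sm(1) cA(1) unfolding smooth_map_def smooth_on_def by blast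
  then have dD: "(?D has_derivative frechet_derivative ?D (at ?y)) (at ?y)"
    using S(2) unfolding numeral_2_eq_2 Ck_on.simps frechet_derivative_works by blast
  have d\<tau>: "((\<tau> \<circ> chart_inv c) has_derivative frechet_derivative (\<tau> \<circ> chart_inv c) (at ?y)) (at ?y)"
    using smooth_map_differentiable[OF sm(2) x c] unfolding frechet_derivative_works .
  have "((\<lambda>y. B (?D y) ((\<tau> \<circ> chart_inv c) y)) has_derivative (\<lambda>v. 0)) (at ?y)"
    by (rule has_derivative_transform_within_open[OF has_derivative_const[of 0] S])
       (rule zero[symmetric])
  from has_derivative_unique[OF this bounded_bilinear.FDERIV[OF signature_bounded_bilinear[OF assms(2)] dD d\<tau>]]
  have "B (?D ?y) (frechet_derivative (\<tau> \<circ> chart_inv c) (at ?y) b) +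
      B (frechet_derivative ?D (at ?y) b) ((\<tau> \<circ> chart_inv c) ?y) = 0"
    by (metis (no_types, lifting))
  then show ?thesis using chart_inv_chart[OF assms(1) cA] by simp
qed

text \<open>The second derivatives of \<open>\<sigma>\<close> in \<open>legendre_second_derivative\<close> commute. If
  \<open>d\<^sub>X \<sigma>\<close> and \<open>d\<^sub>Y \<tau>\<close> are in \<open>f\<close>, it follows that \<open>d\<^sub>Y \<sigma>\<close> and \<open>d\<^sub>X \<tau>\<close> are orthogonal.\<close>

lemma legendre_derivative_symmetric:
  assumes "smooth_atlas A" "signature_4_2 B" "legendre_map A B f"
    and \<sigma>: "local_section A f U \<sigma>" and \<tau>: "local_section A f U \<tau>" and x: "x \<in> U"
  shows "B (dirderiv A x X \<sigma>) (dirderiv A x Y \<tau>) = B (dirderiv A x Y \<sigma>) (dirderiv A x X \<tau>)"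
proof -
  define c where "c = (SOME c. c \<in> charts_at A x)"
  have c: "c \<in> charts_at A x" "c \<in> A" "x \<in> fst c"
    using charts_at_someI[OF assms(1), of x] by (simp_all add: c_def charts_at_def)
  let ?S = "snd c ` (U \<inter> fst c)"
  have "open U" and "smooth_map A U \<sigma>" using \<sigma> unfolding local_section_def by auto
  then have "open ?S" "Ck_on 2 ?S (\<sigma> \<circ> chart_inv c)" "snd c x \<in> ?S"
    using open_chart_image[OF assms(1) c(2)] c x unfolding smooth_map_def smooth_on_def by auto
  note second_derivative_symmetric[OF this, of "X c" "Y c"]
  then show ?thesis
    unfolding dirderiv_def c_def[symmetric] Let_def
    using legendre_second_derivative[OF assms(1-5) x c(1)] by simp
qed

text \<open>Where \<open>\<tau>\<close> vanishes, \<open>legendre_second_derivative\<close> makes \<open>d\<^sub>X \<tau>\<close> a null vector of \<open>f\<^sup>\<bottom>\<close>.\<close>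

lemma legendre_derivative_of_vanishing:
  assumes "smooth_atlas A" "signature_4_2 B" "legendre_map A B f"
    and \<tau>: "local_section A f U \<tau>" and x: "x \<in> U" "\<tau> x = 0" and X: "X \<in> tangent_space A x"
  shows "dirderiv A x X \<tau> \<in> f x"
proof -
  define c where "c = (SOME c. c \<in> charts_at A x)"
  have c: "c \<in> charts_at A x" using charts_at_someI[OF assms(1)] c_def by simp
  interpret B: bounded_bilinear B using signature_bounded_bilinear[OF assms(2)] .
  have "B (dirderiv A x X \<tau>) (dirderiv A x X \<tau>) = 0"
    unfolding dirderiv_def c_def[symmetric] Let_def
    using legendre_second_derivative[OF assms(1-3) \<tau> \<tau> x(1) c] x(2) by (simp add: B.zero_right)
  then show ?thesis
    using perp_isotropic_pos[OF assms(2) legendre_subspace[OF assms(3)] legendre_dim[OF assms(3)]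
        legendre_isotropic[OF assms(3)] legendre_contact[OF assms(3) \<tau> x(1) X]] by force
qed

text \<open>Modulo \<open>f\<close> the derivative of a section depends only on the value of the section, by
  \<open>legendre_derivative_of_vanishing\<close>. Hence the immersion condition need only be tested on two
  sections that span \<open>f\<close> at the point.\<close>

lemma legendre_frame_immersion:
  assumes "smooth_atlas A" "signature_4_2 B" "legendre_map A B f"
    and \<sigma>: "local_section A f U \<sigma>" and \<tau>: "local_section A f U \<tau>" and x: "x \<in> U"
    and span: "f x \<subseteq> span {\<sigma> x, \<tau> x}" and X: "X \<in> tangent_space A x"
    and d\<sigma>: "dirderiv A x X \<sigma> \<in> f x" and d\<tau>: "dirderiv A x X \<tau> \<in> f x"
  shows "X = (\<lambda>c. 0)"
proof (rule legendre_immersion[OF assms(3) X])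
  fix V \<rho> assume \<rho>: "local_section A f V \<rho>" and "x \<in> V"
  let ?W = "U \<inter> V"
  have W: "x \<in> ?W" "open ?W" using x \<open>x \<in> V\<close> \<sigma> \<rho> unfolding local_section_def by auto
  have \<sigma>': "local_section A f ?W \<sigma>" and \<tau>': "local_section A f ?W \<tau>" and \<rho>': "local_section A f ?W \<rho>"
    using local_section_subset[OF \<sigma> W(2)] local_section_subset[OF \<tau> W(2)]
      local_section_subset[OF \<rho> W(2)] by auto
  have sm: "smooth_map A ?W \<sigma>" "smooth_map A ?W \<tau>" "smooth_map A ?W \<rho>"
    using \<sigma>' \<tau>' \<rho>' unfolding local_section_def by auto
  have sub: "subspace (f p)" for p using legendre_subspace[OF assms(3)] .
  have "\<rho> x \<in> span {\<sigma> x, \<tau> x}" using span W(1) \<rho>' unfolding local_section_def by blast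
  then obtain a b where ab: "\<rho> x - a *\<^sub>R \<sigma> x = b *\<^sub>R \<tau> x"
    unfolding span_breakdown_eq span_singleton by blast
  define \<delta> where "\<delta> = (\<lambda>p. \<rho> p + ((- a) *\<^sub>R \<sigma> p + (- b) *\<^sub>R \<tau> p))"
  have sm': "smooth_map A ?W (\<lambda>p. (- a) *\<^sub>R \<sigma> p)" "smooth_map A ?W (\<lambda>p. (- b) *\<^sub>R \<tau> p)"
    by (rule smooth_map_bounded_linear[OF bounded_linear_scaleR_right assms(1) W(2)], fact sm)+
  have sm'': "smooth_map A ?W (\<lambda>p. (- a) *\<^sub>R \<sigma> p + (- b) *\<^sub>R \<tau> p)"
    by (rule smooth_map_add[OF assms(1) W(2) sm'])
  have "smooth_map A ?W \<delta>"
    unfolding \<delta>_def by (rule smooth_map_add[OF assms(1) W(2) sm(3) sm''])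
  then have "local_section A f ?W \<delta>"
    using \<sigma>' \<tau>' \<rho>' unfolding local_section_def
    by (simp add: \<delta>_def subspace_add[OF sub] subspace_diff[OF sub] subspace_scale[OF sub] subspace_neg[OF sub])
  moreover have "\<delta> x = 0" using ab by (simp add: \<delta>_def algebra_simps)
  ultimately have "dirderiv A x X \<delta> \<in> f x"
    using legendre_derivative_of_vanishing[OF assms(1-3)] W(1) X by blast
  moreover have "dirderiv A x X \<delta> =
      dirderiv A x X \<rho> + ((- a) *\<^sub>R dirderiv A x X \<sigma> + (- b) *\<^sub>R dirderiv A x X \<tau>)"
    unfolding \<delta>_def dirderiv_add[OF assms(1) W(1) sm(3) sm''] dirderiv_add[OF assms(1) W(1) sm']
      dirderiv_bounded_linear[OF bounded_linear_scaleR_right assms(1) W(1) sm(1)]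
      dirderiv_bounded_linear[OF bounded_linear_scaleR_right assms(1) W(1) sm(2)] ..
  ultimately have "dirderiv A x X \<rho> =
      dirderiv A x X \<delta> + (a *\<^sub>R dirderiv A x X \<sigma> + b *\<^sub>R dirderiv A x X \<tau>)"
    by simp
  then show "dirderiv A x X \<rho> \<in> f x"
    using \<open>dirderiv A x X \<delta> \<in> f x\<close> d\<sigma> d\<tau>
    by (auto intro!: subspace_add[OF sub] subspace_scale[OF sub])
qed

lemma
  assumes "umbilic_free_with A f s T" "k \<in> {1,2}"
  shows curvature_sphere_subbundle: "subbundle A 1 (s k)"
    and curvature_sphere_subset: "s k p \<subseteq> f p"
    and curvature_subbundle: "rank1_tangent_subbundle A (T k)"
    and curvature_sphere_derivative:
      "local_section A (s k) U \<sigma> \<Longrightarrow> x \<in> U \<Longrightarrow> X \<in> T k x \<Longrightarrow> dirderiv A x X \<sigma> \<in> f x"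
proof -
  have *: "subbundle A 1 (s k) \<and> (\<forall>x. s k x \<subseteq> f x) \<and> rank1_tangent_subbundle A (T k) \<and>
      (\<forall>U \<sigma> x X. local_section A (s k) U \<sigma> \<longrightarrow> x \<in> U \<longrightarrow> X \<in> T k x \<longrightarrow> dirderiv A x X \<sigma> \<in> f x)"
    by (rule bspec[OF conjunct1[OF assms(1)[unfolded umbilic_free_with_def]] assms(2)])
  show "subbundle A 1 (s k)" "s k p \<subseteq> f p" "rank1_tangent_subbundle A (T k)"
    "local_section A (s k) U \<sigma> \<Longrightarrow> x \<in> U \<Longrightarrow> X \<in> T k x \<Longrightarrow> dirderiv A x X \<sigma> \<in> f x"
    using * by simp_all
qed

lemma curvature_spheres_disjoint: "umbilic_free_with A f s T \<Longrightarrow> s 1 x \<inter> s 2 x = {0}"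
  unfolding umbilic_free_with_def by simp

lemma curvature_sphere_frame:
  assumes "legendre_map A B f" "umbilic_free_with A f s T" "i \<in> {1,2}" "j \<in> {1,2}" "i \<noteq> j"
  obtains U \<sigma> \<tau> where "x \<in> U" "local_section A f U \<sigma>" "local_section A f U \<tau>"
    "f x \<subseteq> span {\<sigma> x, \<tau> x}"
    "\<And>X. X \<in> T i x \<Longrightarrow> dirderiv A x X \<sigma> \<in> f x" "\<And>X. X \<in> T j x \<Longrightarrow> dirderiv A x X \<tau> \<in> f x"
proof -
  note sph = curvature_sphere_subbundle[OF assms(2)] curvature_sphere_subset[OF assms(2)]
    and curv = curvature_sphere_derivative[OF assms(2)]
  have int: "s i x \<inter> s j x = {0}"
    using curvature_spheres_disjoint[OF assms(2), of x] assms(3-5) by auto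
  obtain U \<sigma> where \<sigma>: "local_section A (s i) U \<sigma>" "x \<in> U" "s i x = span {\<sigma> x}" "\<sigma> x \<noteq> 0"
    using line_subbundle_frame[OF sph(1)[OF assms(3)], of x] by metis
  obtain V \<tau> where \<tau>: "local_section A (s j) V \<tau>" "x \<in> V" "s j x = span {\<tau> x}" "\<tau> x \<noteq> 0"
    using line_subbundle_frame[OF sph(1)[OF assms(4)], of x] by metis
  let ?W = "U \<inter> V"
  have W: "open ?W" "x \<in> ?W" using \<sigma> \<tau> unfolding local_section_def by auto
  have \<sigma>': "local_section A (s i) ?W \<sigma>" and \<tau>': "local_section A (s j) ?W \<tau>"
    using local_section_subset[OF _ W(1)] \<sigma>(1) \<tau>(1) by auto
  have f\<sigma>: "local_section A f ?W \<sigma>" and f\<tau>: "local_section A f ?W \<tau>"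
    using \<sigma>' \<tau>' sph(2)[OF assms(3)] sph(2)[OF assms(4)] unfolding local_section_def by blast+
  have "\<tau> x \<notin> span {\<sigma> x}"
    using int \<tau>(3,4) \<sigma>(3) span_base[of "\<tau> x" "{\<tau> x}"] by auto
  then have "\<sigma> x \<noteq> \<tau> x" "independent {\<tau> x, \<sigma> x}"
    using \<sigma>(4) span_base[of "\<tau> x" "{\<tau> x}"] by (auto simp: independent_insert)
  then have "f x \<subseteq> span {\<tau> x, \<sigma> x}"
    using f\<sigma> f\<tau> W(2) legendre_dim[OF assms(1), of x] unfolding local_section_def
    by (intro card_ge_dim_independent) auto
  then have "f x \<subseteq> span {\<sigma> x, \<tau> x}" by (simp add: insert_commute)
  then show thesis
    using that[OF W(2) f\<sigma> f\<tau>] curv[OF assms(3) \<sigma>' W(2)] curv[OF assms(4) \<tau>' W(2)] by blast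
qed

section \<open>Gauge potentials\<close>

lemma
  assumes "bounded_bilinear B" "subspace V" "\<And>a b. a \<in> V \<Longrightarrow> b \<in> V \<Longrightarrow> B a b = 0"
    and sym: "\<And>a b. B a b = B b a" and M: "M \<in> wedge_space B V (perp B V)"
  shows wedge_space_annihilates: "v \<in> V \<Longrightarrow> M *v v = 0"
    and wedge_space_perp_image: "w \<in> perp B V \<Longrightarrow> M *v w \<in> V"
proof -
  interpret B: bounded_bilinear B by fact
  have wedge: "wedge B a b *v c = B a c *\<^sub>R b - B b c *\<^sub>R a" for a b c
  proof -
    have "linear (\<lambda>c. B a c *\<^sub>R b - B b c *\<^sub>R a)"
      by (intro linearI) (simp_all add: B.add_right B.scaleR_right algebra_simps)
    from fun_cong[OF matrix_vector_mul(2)[OF this], of c] show ?thesis by (simp add: wedge_def)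
  qed
  have sub: "subspace {M :: real^6^6. M *v v \<in> W}" if W: "subspace W" for v W
    by (rule subspaceI)
       (auto simp: matrix_vector_mult_add_rdistrib scaleR_matrix_vector_assoc[symmetric]
         intro: subspace_0[OF W] subspace_add[OF W] subspace_scale[OF W])
  show "M *v v = 0" if v: "v \<in> V"
  proof -
    have "{wedge B a b |a b. a \<in> V \<and> b \<in> perp B V} \<subseteq> {M. M *v v \<in> {0}}"
      using v assms(3) by (auto simp: wedge perp_def)
    from span_minimal[OF this sub] show ?thesis using M by (auto simp: wedge_space_def)
  qed
  show "M *v w \<in> V" if w: "w \<in> perp B V"
  proof -
    have "{wedge B a b |a b. a \<in> V \<and> b \<in> perp B V} \<subseteq> {M. M *v w \<in> V}"
      using w sym by (auto simp: wedge perp_def intro!: subspace_neg[OF assms(2)] subspace_scale[OF assms(2)])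
    from span_minimal[OF this sub[OF assms(2)]] show ?thesis using M by (auto simp: wedge_space_def)
  qed
qed

lemma bounded_bilinear_matrix_vector_mult:
  "bounded_bilinear (\<lambda>(M :: real^'n^'m) v. M *v v)"
  by (rule bilinear_conv_bounded_bilinear[THEN iffD1])
     (auto simp: bilinear_def matrix_vector_mult_add_rdistrib matrix_vector_right_distrib
       scaleR_matrix_vector_assoc[symmetric] matrix_vector_mult_scaleR intro!: linearI)

lemma
  assumes "signature_4_2 B" "legendre_map A B f" "gauge_potential A B f \<eta>" "X \<in> tangent_space A x"
  shows potential_annihilates: "v \<in> f x \<Longrightarrow> \<eta> x X *v v = 0"
    and potential_perp_image: "w \<in> perp B (f x) \<Longrightarrow> \<eta> x X *v w \<in> f x"
proof -
  have M: "\<eta> x X \<in> wedge_space B (f x) (perp B (f x))"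
    using assms(3,4) unfolding gauge_potential_def by blast
  note facts = signature_bounded_bilinear[OF assms(1)] legendre_subspace[OF assms(2)]
    legendre_isotropic[OF assms(2)] signature_sym[OF assms(1)] M
  show "v \<in> f x \<Longrightarrow> \<eta> x X *v v = 0" by (rule wedge_space_annihilates[OF facts])
  show "w \<in> perp B (f x) \<Longrightarrow> \<eta> x X *v w \<in> f x" by (rule wedge_space_perp_image[OF facts])
qed

text \<open>Since \<open>\<eta>\<close> annihilates \<open>f\<close>, evaluating \<open>d\<eta> = 0\<close> on a section of \<open>f\<close> gives an algebraic identity.\<close>

lemma closed_potential_symmetric:
  assumes "smooth_atlas A" "signature_4_2 B" "legendre_map A B f" "gauge_potential A B f \<eta>"
    and \<sigma>: "local_section A f U \<sigma>" and x: "x \<in> U"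
    and X: "X \<in> tangent_space A x" and Y: "Y \<in> tangent_space A x"
  shows "\<eta> x X *v dirderiv A x Y \<sigma> = \<eta> x Y *v dirderiv A x X \<sigma>"
proof -
  define c where "c = (SOME c. c \<in> charts_at A x)"
  have c: "c \<in> charts_at A x" "c \<in> A" "x \<in> fst c"
    using charts_at_someI[OF assms(1), of x] by (simp_all add: c_def charts_at_def)
  let ?W = "U \<inter> fst c"
  have W: "open ?W" "x \<in> ?W"
    using \<sigma> x c open_chart_domain[OF assms(1) c(2)] unfolding local_section_def by auto
  have sm\<sigma>: "smooth_map A ?W \<sigma>"
    using \<sigma> smooth_map_subset unfolding local_section_def by blast
  have sm\<eta>: "smooth_map A ?W (\<lambda>p. \<eta> p (coord_field A c v p))" for v
    using assms(4) c(2) smooth_map_subset[of A "fst c" _ ?W]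
    unfolding gauge_potential_def one_form_def by blast
  have prod: "\<eta> x Z *v dirderiv A x Z' \<sigma> +
      dirderiv A x Z' (\<lambda>p. \<eta> p (coord_field A c (Z c) p)) *v \<sigma> x = 0"
    if Z: "Z \<in> tangent_space A x" for Z Z'
  proof -
    have "\<eta> p (coord_field A c (Z c) p) *v \<sigma> p = 0" if p: "p \<in> ?W" for p
    proof -
      have "coord_field A c (Z c) p \<in> tangent_space A p" "\<sigma> p \<in> f p"
        using p c(2) \<sigma> coord_field_tangent[OF assms(1), of c p]
        unfolding local_section_def charts_at_def by auto
      then show ?thesis using potential_annihilates[OF assms(2-4)] by blast
    qed
    then have "dirderiv A x Z' (\<lambda>p. \<eta> p (coord_field A c (Z c) p) *v \<sigma> p) = 0"
      using dirderiv_cong[OF assms(1) W smooth_map_const, of 0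
          "\<lambda>p. \<eta> p (coord_field A c (Z c) p) *v \<sigma> p" Z'] by simp
    then show ?thesis
      using dirderiv_bilinear[OF bounded_bilinear_matrix_vector_mult assms(1) W(2) sm\<eta> sm\<sigma>, of Z' "Z c"]
        coord_field_eq[OF Z c(1)] by simp
  qed
  have "ext_deriv A c \<eta> x X Y = 0"
    using assms(4) X Y c(1) unfolding gauge_potential_def closed_form_def by blast
  then have "dirderiv A x X (\<lambda>p. \<eta> p (coord_field A c (Y c) p)) =
      dirderiv A x Y (\<lambda>p. \<eta> p (coord_field A c (X c) p))"
    unfolding ext_deriv_def by simp
  then show ?thesis
    using prod[OF X, of Y, folded eq_neg_iff_add_eq_0] prod[OF Y, of X, folded eq_neg_iff_add_eq_0] by simp
qed

lemma potential_zero_tangent: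
  assumes "gauge_potential A B f \<eta>" "X \<in> tangent_space A x"
  shows "\<eta> x (\<lambda>c. 0) = 0"
proof -
  have "\<eta> x (\<lambda>c. 0 *\<^sub>R X c + 0 *\<^sub>R X c) = 0 *\<^sub>R \<eta> x X + 0 *\<^sub>R \<eta> x X"
    using assms unfolding gauge_potential_def one_form_def by blast
  then show ?thesis by simp
qed

text \<open>The key point. Let \<open>\<sigma>\<close>, \<open>\<tau>\<close> span \<open>s i\<close>, \<open>s j\<close> and let \<open>X \<in> T i\<close>, \<open>Y \<in> T j\<close> be non-zero. Since
  \<open>d\<^sub>X \<tau>\<close> and \<open>d\<^sub>Y \<sigma>\<close> give an orthogonal basis of \<open>f\<^sup>\<bottom>/f\<close>, the vector \<open>w\<close> lies in the span of \<open>f\<close>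
  and \<open>d\<^sub>Y \<sigma>\<close>, and \<open>\<eta>(X) d\<^sub>Y \<sigma> = \<eta>(Y) d\<^sub>X \<sigma> = 0\<close> because \<open>d\<^sub>X \<sigma>\<close> is in \<open>f\<close>.\<close>

lemma potential_annihilates_perp_derivative:
  assumes "smooth_atlas A" "signature_4_2 B" "legendre_map A B f" "gauge_potential A B f \<eta>"
    and uf: "umbilic_free_with A f s T" and i: "i \<in> {1,2}" and X: "X \<in> T i x"
    and w: "w \<in> perp B (f x)"
    and orth: "\<And>U \<sigma>. local_section A f U \<sigma> \<Longrightarrow> x \<in> U \<Longrightarrow> B w (dirderiv A x X \<sigma>) = 0"
  shows "\<eta> x X *v w = 0"
proof (cases "X = (\<lambda>c. 0)")
  case True
  have "X \<in> tangent_space A x"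
    using rank1_tangent_subbundleD(1)[OF assms(1) curvature_subbundle[OF uf i]] X by blast
  then show ?thesis using potential_zero_tangent[OF assms(4)] True by simp
next
  case False
  define j where "j = 3 - i"
  have j: "j \<in> {1,2}" "i \<noteq> j" using i by (auto simp: j_def)
  have T: "T k x \<subseteq> tangent_space A x" "\<exists>Z\<in>T k x. Z \<noteq> (\<lambda>c. 0)" if "k \<in> {1,2}" for k
    using rank1_tangent_subbundleD[OF assms(1) curvature_subbundle[OF uf that]] by simp_all
  obtain Y where Y: "Y \<in> T j x" "Y \<noteq> (\<lambda>c. 0)" using T(2)[OF j(1)] by blast
  have tan: "X \<in> tangent_space A x" "Y \<in> tangent_space A x" using T(1) i j X Y by blast+
  obtain U \<sigma> \<tau> where U: "x \<in> U" and \<sigma>: "local_section A f U \<sigma>" and \<tau>: "local_section A f U \<tau>"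
    and span: "f x \<subseteq> span {\<sigma> x, \<tau> x}"
    and d\<sigma>: "\<And>X. X \<in> T i x \<Longrightarrow> dirderiv A x X \<sigma> \<in> f x" and d\<tau>: "\<And>X. X \<in> T j x \<Longrightarrow> dirderiv A x X \<tau> \<in> f x"
    using curvature_sphere_frame[OF assms(3) uf i j, where x = x and thesis = thesis] by blast
  let ?u = "dirderiv A x X \<tau>" and ?y = "dirderiv A x Y \<sigma>"
  have u: "?u \<in> perp B (f x)" "?u \<notin> f x"
    using legendre_contact[OF assms(3) \<tau> U tan(1)]
      legendre_frame_immersion[OF assms(1-3) \<sigma> \<tau> U span tan(1) d\<sigma>[OF X]] False by auto
  have y: "?y \<in> perp B (f x)" "?y \<notin> f x"
    using legendre_contact[OF assms(3) \<sigma> U tan(2)]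
      legendre_frame_immersion[OF assms(1-3) \<sigma> \<tau> U span tan(2) _ d\<tau>[OF Y(1)]] Y(2) by auto
  have "B ?u ?y = B (dirderiv A x Y \<tau>) (dirderiv A x X \<sigma>)"
    by (rule legendre_derivative_symmetric[OF assms(1-3) \<tau> \<sigma> U])
  also have "\<dots> = 0" using legendre_isotropic[OF assms(3)] d\<tau>[OF Y(1)] d\<sigma>[OF X] by blast
  finally have uy: "B ?u ?y = 0" .
  obtain k where k: "w - k *\<^sub>R ?y \<in> f x"
    using perp_isotropic_plane[OF assms(2) legendre_subspace[OF assms(3)] legendre_dim[OF assms(3)]
        legendre_isotropic[OF assms(3), where x = x] u y w uy orth[OF \<tau> U]] .
  have "\<eta> x X *v ?y = \<eta> x Y *v dirderiv A x X \<sigma>"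
    by (rule closed_potential_symmetric[OF assms(1-4) \<sigma> U tan])
  also have "\<dots> = 0" by (rule potential_annihilates[OF assms(2-4) tan(2) d\<sigma>[OF X]])
  finally have "\<eta> x X *v ?y = 0" .
  moreover have "\<eta> x X *v (w - k *\<^sub>R ?y) = 0" by (rule potential_annihilates[OF assms(2-4) tan(1) k])
  ultimately show ?thesis by (simp add: matrix_vector_mult_diff_distrib matrix_vector_mult_scaleR)
qed

section \<open>Gauge transformations and Calapso transforms\<close>

lemma orthogonal_group_preserves: "M \<in> orthogonal_group B \<Longrightarrow> B (M *v u) (M *v v) = B u v"
  unfolding orthogonal_group_def by simp

lemma
  assumes "signature_4_2 B" "M \<in> orthogonal_group B"
  shows orthogonal_inv_left: "matrix_inv M *v (M *v v) = v"
    and orthogonal_inv_right: "M *v (matrix_inv M *v v) = v"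
    and orthogonal_inv_mem: "matrix_inv M \<in> orthogonal_group B"
proof -
  obtain K where K: "K M = matrix_inv M" "K M ** M = mat 1 \<and> M ** K M = mat 1"
    using orthogonal_group_inverse[OF assms(1)] assms(2) by metis
  then show *: "matrix_inv M *v (M *v v) = v" "M *v (matrix_inv M *v v) = v" for v
    by (simp_all add: matrix_vector_mul_assoc)
  have "B (matrix_inv M *v u) (matrix_inv M *v v) = B (M *v (matrix_inv M *v u)) (M *v (matrix_inv M *v v))" for u v
    by (rule orthogonal_group_preserves[OF assms(2), symmetric])
  then show "matrix_inv M \<in> orthogonal_group B" unfolding orthogonal_group_def by (simp add: *)
qed

lemma smooth_map_orthogonal_inv:
  assumes "smooth_atlas A" "signature_4_2 B" "open U" "smooth_map A U G" "\<And>p. G p \<in> orthogonal_group B"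
  shows "smooth_map A U (\<lambda>p. matrix_inv (G p))"
proof -
  obtain K where K: "bounded_linear K" "\<And>M. M \<in> orthogonal_group B \<Longrightarrow> K M = matrix_inv M"
    using orthogonal_group_inverse[OF assms(2)] by metis
  have "smooth_map A U (\<lambda>p. K (G p))" by (rule smooth_map_bounded_linear[OF K(1) assms(1,3,4)])
  then show ?thesis using K(2) assms(5) by simp
qed

lemma perp_orthogonal_image:
  assumes "M \<in> orthogonal_group B" "w \<in> perp B V"
  shows "M *v w \<in> perp B ((\<lambda>v. M *v v) ` V)"
  using assms unfolding perp_def orthogonal_group_def by simp

lemma subbundle_orthogonal_image:
  assumes "smooth_atlas A" "signature_4_2 B" "smooth_map A UNIV M" "\<And>p. M p \<in> orthogonal_group B"
    and "subbundle A k F"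
  shows "subbundle A k (\<lambda>p. (\<lambda>v. M p *v v) ` F p)"
  unfolding subbundle_def
proof
  fix x
  obtain U e where U: "open U" "x \<in> U" "\<And>j. j < k \<Longrightarrow> smooth_map A U (e j)"
    and span: "\<And>p. p \<in> U \<Longrightarrow> F p = span ((\<lambda>j::nat. e j p) ` {..<k})" and dim: "\<And>p. p \<in> U \<Longrightarrow> dim (F p) = k"
    using subbundle_frame[OF assms(5), where x = x and thesis = thesis] by blast
  have sm: "smooth_map A U (\<lambda>p. M p *v e j p)" if "j < k" for j
    by (rule smooth_map_bilinear[OF bounded_bilinear_matrix_vector_mult assms(1) U(1)
          smooth_map_subset[OF assms(3) subset_UNIV] U(3)[OF that]])
  have lin: "linear (\<lambda>v. M p *v v)" for p by simp
  have inj: "inj (\<lambda>v. M p *v v)" for p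
    by (rule inj_on_inverseI[of _ "\<lambda>v. matrix_inv (M p) *v v"])
       (rule orthogonal_inv_left[OF assms(2) assms(4)])
  have img: "(\<lambda>v. M p *v v) ` F p = span ((\<lambda>j. M p *v e j p) ` {..<k})" if "p \<in> U" for p
    unfolding span[OF that] linear_span_image[OF lin, symmetric] by (simp add: image_image)
  have dimg: "dim ((\<lambda>v. M p *v v) ` F p) = k" if "p \<in> U" for p
    using dim_image_eq[OF lin inj_on_subset[OF inj subset_UNIV]] dim[OF that] by simp
  show "\<exists>U e. open U \<and> x \<in> U \<and> (\<forall>j<k. smooth_map A U (e j)) \<and>
     (\<forall>p\<in>U. (\<lambda>v. M p *v v) ` F p = span ((\<lambda>j::nat. e j p) ` {..<k}) \<and> dim ((\<lambda>v. M p *v v) ` F p) = k)"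
    by (rule exI[of _ U], rule exI[of _ "\<lambda>j p. M p *v e j p"]) (use U(1,2) sm img dimg in blast)
qed

lemma
  assumes "trivialising_gauge A B \<eta> t G"
  shows gauge_smooth: "smooth_map A UNIV G" and gauge_orthogonal: "G p \<in> orthogonal_group B"
  using assms unfolding trivialising_gauge_def by blast+

lemma gauge_equation:
  assumes "trivialising_gauge A B \<eta> t G" "open U" "smooth_map A U v" "x \<in> U" "X \<in> tangent_space A x"
  shows "G x *v (dirderiv A x X (\<lambda>p. matrix_inv (G p) *v v p) +
                t *\<^sub>R (\<eta> x X *v (matrix_inv (G x) *v v x))) = dirderiv A x X v"
  using assms unfolding trivialising_gauge_def by blast

lemma gauge_derivative:
  assumes "smooth_atlas A" "signature_4_2 B" "trivialising_gauge A B \<eta> t G"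
    and "open U" "smooth_map A U \<sigma>" "x \<in> U" "X \<in> tangent_space A x"
  shows "dirderiv A x X (\<lambda>p. G p *v \<sigma> p) = G x *v (dirderiv A x X \<sigma> + t *\<^sub>R (\<eta> x X *v \<sigma> x))"
proof -
  have sm: "smooth_map A U (\<lambda>p. G p *v \<sigma> p)"
    by (rule smooth_map_bilinear[OF bounded_bilinear_matrix_vector_mult assms(1,4)
          smooth_map_subset[OF gauge_smooth[OF assms(3)] subset_UNIV] assms(5)])
  show ?thesis
    using gauge_equation[OF assms(3,4) sm assms(6,7)]
    by (simp add: orthogonal_inv_left[OF assms(2) gauge_orthogonal[OF assms(3)]])
qed

lemma gauge_inverse_derivative:
  assumes "smooth_atlas A" "signature_4_2 B" "trivialising_gauge A B \<eta> t G" "X \<in> tangent_space A x"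
  shows "dirderiv A x X (\<lambda>p. matrix_inv (G p) *v v) = (- t) *\<^sub>R (\<eta> x X *v (matrix_inv (G x) *v v))"
proof -
  let ?d = "dirderiv A x X (\<lambda>p. matrix_inv (G p) *v v)" and ?e = "t *\<^sub>R (\<eta> x X *v (matrix_inv (G x) *v v))"
  have "G x *v (?d + ?e) = 0"
    using gauge_equation[OF assms(3) open_UNIV smooth_map_const UNIV_I assms(4), of v] by simp
  then have "matrix_inv (G x) *v (G x *v (?d + ?e)) = 0" by simp
  then have "?d + ?e = 0"
    unfolding orthogonal_inv_left[OF assms(2) gauge_orthogonal[OF assms(3)]] .
  then show ?thesis by (simp add: add_eq_0_iff2)
qed

text \<open>The potential does not contribute on sections of \<open>f\<close>, which it annihilates; hence the contact
  geometry of first order of \<open>f\<close> is carried over to its Calapso transforms.\<close>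

lemma gauge_section_derivative:
  assumes "smooth_atlas A" "signature_4_2 B" "legendre_map A B f" "gauge_potential A B f \<eta>"
    and "trivialising_gauge A B \<eta> t G" "local_section A f U \<sigma>" "x \<in> U" "X \<in> tangent_space A x"
  shows "dirderiv A x X (\<lambda>p. G p *v \<sigma> p) = G x *v dirderiv A x X \<sigma>"
proof -
  have \<sigma>: "open U" "smooth_map A U \<sigma>" "\<sigma> x \<in> f x" using assms(6,7) unfolding local_section_def by auto
  then show ?thesis
    using gauge_derivative[OF assms(1,2,5) \<sigma>(1,2) assms(7,8)]
      potential_annihilates[OF assms(2-4,8) \<sigma>(3)] by simp
qed

lemma local_section_orthogonal_image:
  assumes "smooth_atlas A" "smooth_map A UNIV M" "local_section A F U \<sigma>"
  shows "local_section A (\<lambda>p. (\<lambda>v. M p *v v) ` F p) U (\<lambda>p. M p *v \<sigma> p)"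
  using assms(3) smooth_map_bilinear[OF bounded_bilinear_matrix_vector_mult assms(1) _
      smooth_map_subset[OF assms(2) subset_UNIV]]
  unfolding local_section_def by blast

lemma local_section_gauge_image:
  assumes "smooth_atlas A" "signature_4_2 B" "trivialising_gauge A B \<eta> t G"
    and \<tau>: "local_section A (\<lambda>p. (\<lambda>v. G p *v v) ` F p) U \<tau>"
  obtains \<sigma> where "local_section A F U \<sigma>" "\<tau> = (\<lambda>p. G p *v \<sigma> p)"
proof
  note orth = gauge_orthogonal[OF assms(3)]
  have "smooth_map A UNIV (\<lambda>p. matrix_inv (G p))"
    by (rule smooth_map_orthogonal_inv[OF assms(1,2) open_UNIV gauge_smooth[OF assms(3)] orth])
  from local_section_orthogonal_image[OF assms(1) this \<tau>]
  show "local_section A F U (\<lambda>p. matrix_inv (G p) *v \<tau> p)"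
    by (simp add: image_image orthogonal_inv_left[OF assms(2) orth])
  show "\<tau> = (\<lambda>p. G p *v (matrix_inv (G p) *v \<tau> p))"
    by (simp add: orthogonal_inv_right[OF assms(2) orth])
qed

lemma calapso_legendre:
  assumes "smooth_atlas A" "signature_4_2 B" "legendre_map A B f" "gauge_potential A B f \<eta>"
    and "trivialising_gauge A B \<eta> t G"
  shows "legendre_map A B (\<lambda>p. (\<lambda>v. G p *v v) ` f p)"
    (is "legendre_map A B ?g")
  unfolding legendre_map_def
proof (intro conjI allI ballI impI)
  note orth = gauge_orthogonal[OF assms(5)]
  have B: "B (G p *v u) (G p *v v) = B u v" for p u v
    by (rule orthogonal_group_preserves[OF orth])
  have "subbundle A 2 f" using assms(3) unfolding legendre_map_def by blast
  then show "subbundle A 2 ?g"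
    by (rule subbundle_orthogonal_image[OF assms(1,2) gauge_smooth[OF assms(5)] orth])
  show "B u v = 0" if "u \<in> ?g x" "v \<in> ?g x" for x u v
    using that legendre_isotropic[OF assms(3)] by (auto simp: B)
  show "derived_set A ?g x \<subseteq> perp B (?g x)" for x
  proof
    fix w assume "w \<in> derived_set A ?g x"
    then obtain U \<tau> where \<tau>: "local_section A ?g U \<tau>" and x: "x \<in> U"
      and w: "w = \<tau> x \<or> (\<exists>X\<in>tangent_space A x. w = dirderiv A x X \<tau>)"
      unfolding derived_set_def by blast
    obtain \<sigma> where \<sigma>: "local_section A f U \<sigma>" "\<tau> = (\<lambda>p. G p *v \<sigma> p)"
      by (rule local_section_gauge_image[OF assms(1,2,5) \<tau>])
    have "\<sigma> x \<in> perp B (f x)"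
      using \<sigma>(1) x legendre_isotropic[OF assms(3)] unfolding local_section_def perp_def by blast
    moreover have "dirderiv A x X \<sigma> \<in> perp B (f x)" if "X \<in> tangent_space A x" for X
      by (rule legendre_contact[OF assms(3) \<sigma>(1) x that])
    ultimately show "w \<in> perp B (?g x)"
      using w gauge_section_derivative[OF assms \<sigma>(1) x] perp_orthogonal_image[OF orth]
      unfolding \<sigma>(2) by auto
  qed
  show "X = (\<lambda>c. 0)" if X: "X \<in> tangent_space A x"
    and imm: "\<forall>U \<tau>. local_section A ?g U \<tau> \<longrightarrow> x \<in> U \<longrightarrow> dirderiv A x X \<tau> \<in> ?g x" for x X
  proof (rule legendre_immersion[OF assms(3) X])
    fix U \<sigma> assume \<sigma>: "local_section A f U \<sigma>" and x: "x \<in> U"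
    have "dirderiv A x X (\<lambda>p. G p *v \<sigma> p) \<in> ?g x"
      using imm local_section_orthogonal_image[OF assms(1) gauge_smooth[OF assms(5)] \<sigma>] x by blast
    then obtain v where "v \<in> f x" "G x *v dirderiv A x X \<sigma> = G x *v v"
      unfolding gauge_section_derivative[OF assms \<sigma> x X] by blast
    then show "dirderiv A x X \<sigma> \<in> f x"
      using orthogonal_inv_left[OF assms(2) orth] by metis
  qed
qed

lemma calapso_umbilic_free:
  assumes "smooth_atlas A" "signature_4_2 B" "legendre_map A B f" "gauge_potential A B f \<eta>"
    and "trivialising_gauge A B \<eta> t G" and uf: "umbilic_free_with A f s T"
  shows "umbilic_free_with A (\<lambda>p. (\<lambda>v. G p *v v) ` f p) (\<lambda>k p. (\<lambda>v. G p *v v) ` s k p) T"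
    (is "umbilic_free_with A ?g ?s T")
  unfolding umbilic_free_with_def
proof (intro conjI ballI allI impI)
  note orth = gauge_orthogonal[OF assms(5)]
  fix k :: nat assume k: "k \<in> {1,2}"
  show "subbundle A 1 (?s k)"
    by (rule subbundle_orthogonal_image[OF assms(1,2) gauge_smooth[OF assms(5)] orth
          curvature_sphere_subbundle[OF uf k]])
  show "?s k x \<subseteq> ?g x" for x
    using curvature_sphere_subset[OF uf k] by (rule image_mono)
  show "rank1_tangent_subbundle A (T k)" by (rule curvature_subbundle[OF uf k])
  fix U \<tau> x X assume \<tau>: "local_section A (?s k) U \<tau>" and x: "x \<in> U" and X: "X \<in> T k x"
  have tan: "X \<in> tangent_space A x"
    using rank1_tangent_subbundleD(1)[OF assms(1) curvature_subbundle[OF uf k]] X by blast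
  obtain \<sigma> where \<sigma>: "local_section A (s k) U \<sigma>" "\<tau> = (\<lambda>p. G p *v \<sigma> p)"
    by (rule local_section_gauge_image[OF assms(1,2,5) \<tau>])
  have "local_section A f U \<sigma>"
    using \<sigma>(1) curvature_sphere_subset[OF uf k] unfolding local_section_def by blast
  then show "dirderiv A x X \<tau> \<in> ?g x"
    using gauge_section_derivative[OF assms(1-5) _ x tan] curvature_sphere_derivative[OF uf k \<sigma>(1) x X]
    unfolding \<sigma>(2) by simp
next
  note orth = gauge_orthogonal[OF assms(5)]
  fix x
  have "inj (\<lambda>v. G x *v v)"
    by (rule inj_on_inverseI[of _ "\<lambda>v. matrix_inv (G x) *v v"])
       (rule orthogonal_inv_left[OF assms(2) orth])
  then have "?s 1 x \<inter> ?s 2 x = (\<lambda>v. G x *v v) ` (s 1 x \<inter> s 2 x)"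
    by (simp add: image_Int)
  then show "?s 1 x \<inter> ?s 2 x = {0}" using curvature_spheres_disjoint[OF uf, of x] by simp
qed

section \<open>Spherical curvature lines\<close>

text \<open>A field of vectors \<open>w \<in> f\<^sup>\<bottom>\<close> along a curvature line whose derivative is a multiple of
  \<open>\<eta>(\<gamma>') w \<in> f\<close> is orthogonal to the derivatives of \<open>f\<close> along the curve, so \<open>\<eta>(\<gamma>') w = 0\<close>.
  The case \<open>k = 0\<close> is that of a constant vector, and \<open>k = - t\<close> that of a \<open>d + t\<eta>\<close>-parallel field.\<close>

lemma potential_annihilates_along_curvature_line:
  assumes "smooth_atlas A" "signature_4_2 B" "legendre_map A B f" "gauge_potential A B f \<eta>"
    and uf: "umbilic_free_with A f s T" and i: "i \<in> {1,2}"
    and \<gamma>: "integral_curve A (T i) J \<gamma>" and r: "r \<in> J"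
    and w: "\<And>q. q \<in> J \<Longrightarrow> w q \<in> perp B (f (\<gamma> q))"
    and dw: "(w has_vector_derivative k *\<^sub>R (\<eta> (\<gamma> r) (velocity A \<gamma> r) *v w r)) (at r)"
  shows "\<eta> (\<gamma> r) (velocity A \<gamma> r) *v w r = 0"
proof -
  have J: "open J" "continuous_on J \<gamma>" and X: "velocity A \<gamma> r \<in> T i (\<gamma> r)"
    using \<gamma> r unfolding integral_curve_def by auto
  let ?X = "velocity A \<gamma> r" and ?x = "\<gamma> r"
  have tan: "?X \<in> tangent_space A ?x"
    using rank1_tangent_subbundleD(1)[OF assms(1) curvature_subbundle[OF uf i]] X by blast
  show ?thesis
  proof (rule potential_annihilates_perp_derivative[OF assms(1-4) uf i X w[OF r]])
    fix U \<sigma> assume \<sigma>: "local_section A f U \<sigma>" and x: "?x \<in> U"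
    then have U: "open U" "smooth_map A U \<sigma>" "\<And>p. p \<in> U \<Longrightarrow> \<sigma> p \<in> f p" unfolding local_section_def by auto
    let ?N = "J \<inter> \<gamma> -` U"
    have N: "open ?N" "r \<in> ?N" using J U(1) r x by (simp_all add: continuous_on_open_vimage Int_commute)
    have d\<sigma>: "((\<lambda>q. \<sigma> (\<gamma> q)) has_vector_derivative dirderiv A ?x ?X \<sigma>) (at r)"
      by (rule has_vector_derivative_along_curve[OF assms(1) \<gamma> r U(1,2) x])
    have "((\<lambda>q. B (w q) (\<sigma> (\<gamma> q))) has_vector_derivative 0) (at r)"
      by (rule has_vector_derivative_transform_within_open[OF has_vector_derivative_const[of 0] N])
         (use w U(3) in \<open>auto simp: perp_def\<close>)
    moreover have "((\<lambda>q. B (w q) (\<sigma> (\<gamma> q))) has_vector_derivative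
        B (w r) (dirderiv A ?x ?X \<sigma>) + B (k *\<^sub>R (\<eta> ?x ?X *v w r)) (\<sigma> ?x)) (at r)"
      by (rule bounded_bilinear.has_vector_derivative[OF signature_bounded_bilinear[OF assms(2)] dw d\<sigma>])
    moreover have "B (k *\<^sub>R (\<eta> ?x ?X *v w r)) (\<sigma> ?x) = 0"
      using potential_perp_image[OF assms(2-4) tan w[OF r]] legendre_subspace[OF assms(3), of ?x] U(3)[OF x]
      by (intro legendre_isotropic[OF assms(3)] subspace_scale)
    ultimately show "B (w r) (dirderiv A ?x ?X \<sigma>) = 0"
      using vector_derivative_unique_at by fastforce
  qed
qed

lemma constant_of_zero_vector_derivative:
  fixes h :: "real \<Rightarrow> 'b::real_normed_vector"
  assumes "open J" "connected J" "\<And>r. r \<in> J \<Longrightarrow> (h has_vector_derivative 0) (at r)" "a \<in> J" "b \<in> J"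
  shows "h b = h a"
proof -
  have "convex J" using assms(2) by (simp add: is_interval_connected_1[symmetric] is_interval_convex_1[symmetric])
  then obtain c where "\<And>r. r \<in> J \<Longrightarrow> h r = c"
    using has_vector_derivative_zero_constant[of J h] assms(3) has_vector_derivative_at_within by metis
  then show ?thesis using assms(4,5) by simp
qed

text \<open>A fixed vector \<open>v \<in> L\<close> satisfies \<open>d(G v) = t G \<eta>(\<gamma>') v = 0\<close> along a leaf.\<close>

lemma gauge_constant_on_leaves:
  assumes "smooth_atlas A" "signature_4_2 B" "legendre_map A B f" "gauge_potential A B f \<eta>"
    and gauge: "trivialising_gauge A B \<eta> t G" and uf: "umbilic_free_with A f s T" and i: "i \<in> {1,2}"
    and L: "\<And>x. L x \<subseteq> perp B (f x)" and const: "\<And>x y. y \<in> leaf A (T i) x \<Longrightarrow> L y = L x"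
    and y: "y \<in> leaf A (T i) x"
  shows "(\<lambda>v. G y *v v) ` L y = (\<lambda>v. G x *v v) ` L x"
proof -
  obtain J \<gamma> a b where \<gamma>: "integral_curve A (T i) J \<gamma>" and ab: "a \<in> J" "b \<in> J" "\<gamma> a = x" "\<gamma> b = y"
    using y unfolding leaf_def by blast
  have J: "open J" "connected J" and X: "\<And>r. r \<in> J \<Longrightarrow> velocity A \<gamma> r \<in> T i (\<gamma> r)"
    using \<gamma> unfolding integral_curve_def by auto
  have "G y *v v = G x *v v" if v: "v \<in> L x" for v
  proof -
    have perp: "v \<in> perp B (f (\<gamma> q))" if q: "q \<in> J" for q
    proof -
      have "\<gamma> q \<in> leaf A (T i) x" unfolding leaf_def using \<gamma> ab q by blast
      then show ?thesis using const L v by blast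
    qed
    have "((\<lambda>q. G (\<gamma> q) *v v) has_vector_derivative 0) (at r)" if r: "r \<in> J" for r
    proof -
      have tan: "velocity A \<gamma> r \<in> tangent_space A (\<gamma> r)"
        using rank1_tangent_subbundleD(1)[OF assms(1) curvature_subbundle[OF uf i]] X[OF r] by blast
      have "\<eta> (\<gamma> r) (velocity A \<gamma> r) *v v = 0"
        by (rule potential_annihilates_along_curvature_line[OF assms(1-4) uf i \<gamma> r, of "\<lambda>q. v" 0])
           (use perp in auto)
      then have "dirderiv A (\<gamma> r) (velocity A \<gamma> r) (\<lambda>p. G p *v v) = 0"
        using gauge_derivative[OF assms(1,2) gauge open_UNIV smooth_map_const UNIV_I tan, of v] by simp
      moreover have "smooth_map A UNIV (\<lambda>p. G p *v v)"
        by (rule smooth_map_bilinear[OF bounded_bilinear_matrix_vector_mult assms(1) open_UNIV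
              gauge_smooth[OF gauge] smooth_map_const])
      ultimately show ?thesis
        using has_vector_derivative_along_curve[OF assms(1) \<gamma> r open_UNIV _ UNIV_I, of "\<lambda>p. G p *v v"] by simp
    qed
    from constant_of_zero_vector_derivative[OF J this ab(1,2)] show ?thesis using ab by simp
  qed
  then show ?thesis using const[OF y] by (metis (no_types, lifting) image_cong)
qed

text \<open>For a fixed vector \<open>v \<in> L\<close> the field \<open>w = G\<^sup>-\<^sup>1 v\<close> satisfies \<open>dw = - t \<eta>(\<gamma>') w\<close> along a leaf.\<close>

lemma gauge_inverse_constant_on_leaves:
  assumes "smooth_atlas A" "signature_4_2 B" "legendre_map A B f" "gauge_potential A B f \<eta>"
    and gauge: "trivialising_gauge A B \<eta> t G" and uf: "umbilic_free_with A f s T" and i: "i \<in> {1,2}"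
    and L: "\<And>x. L x \<subseteq> perp B ((\<lambda>v. G x *v v) ` f x)"
    and const: "\<And>x y. y \<in> leaf A (T i) x \<Longrightarrow> L y = L x"
    and y: "y \<in> leaf A (T i) x"
  shows "(\<lambda>v. matrix_inv (G y) *v v) ` L y = (\<lambda>v. matrix_inv (G x) *v v) ` L x"
proof -
  note orth = gauge_orthogonal[OF gauge]
  obtain J \<gamma> a b where \<gamma>: "integral_curve A (T i) J \<gamma>" and ab: "a \<in> J" "b \<in> J" "\<gamma> a = x" "\<gamma> b = y"
    using y unfolding leaf_def by blast
  have J: "open J" "connected J" and X: "\<And>r. r \<in> J \<Longrightarrow> velocity A \<gamma> r \<in> T i (\<gamma> r)"
    using \<gamma> unfolding integral_curve_def by auto
  have "matrix_inv (G y) *v v = matrix_inv (G x) *v v" if v: "v \<in> L x" for v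
  proof -
    let ?w = "\<lambda>q. matrix_inv (G (\<gamma> q)) *v v"
    have perp: "?w q \<in> perp B (f (\<gamma> q))" if q: "q \<in> J" for q
    proof -
      have "\<gamma> q \<in> leaf A (T i) x" unfolding leaf_def using \<gamma> ab q by blast
      then have "v \<in> perp B ((\<lambda>v. G (\<gamma> q) *v v) ` f (\<gamma> q))" using const L v by blast
      from perp_orthogonal_image[OF orthogonal_inv_mem[OF assms(2) orth[of "\<gamma> q"]] this]
      show ?thesis by (simp add: image_image orthogonal_inv_left[OF assms(2) orth])
    qed
    have "(?w has_vector_derivative 0) (at r)" if r: "r \<in> J" for r
    proof -
      have tan: "velocity A \<gamma> r \<in> tangent_space A (\<gamma> r)"
        using rank1_tangent_subbundleD(1)[OF assms(1) curvature_subbundle[OF uf i]] X[OF r] by blast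
      have "smooth_map A UNIV (\<lambda>p. matrix_inv (G p) *v v)"
        by (rule smooth_map_bilinear[OF bounded_bilinear_matrix_vector_mult assms(1) open_UNIV
              smooth_map_orthogonal_inv[OF assms(1,2) open_UNIV gauge_smooth[OF gauge] orth] smooth_map_const])
      from has_vector_derivative_along_curve[OF assms(1) \<gamma> r open_UNIV this UNIV_I]
      have d: "(?w has_vector_derivative (- t) *\<^sub>R (\<eta> (\<gamma> r) (velocity A \<gamma> r) *v ?w r)) (at r)"
        unfolding gauge_inverse_derivative[OF assms(1,2) gauge tan] .
      have "\<eta> (\<gamma> r) (velocity A \<gamma> r) *v ?w r = 0"
        by (rule potential_annihilates_along_curvature_line[OF assms(1-4) uf i \<gamma> r perp d])
      then show ?thesis using d by simp
    qed
    from constant_of_zero_vector_derivative[OF J this ab(1,2)] show ?thesis using ab by simp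
  qed
  then show ?thesis using const[OF y] by (metis (no_types, lifting) image_cong)
qed

theorem proposition6p9:
  fixes A :: "('a::{t2_space,second_countable_topology}) chart set"
    and B :: "real^6 \<Rightarrow> real^6 \<Rightarrow> real"
    and f :: "'a \<Rightarrow> (real^6) set"
    and s :: "nat \<Rightarrow> 'a \<Rightarrow> (real^6) set"
    and T :: "nat \<Rightarrow> 'a \<Rightarrow> 'a tangent set"
    and i :: nat
  assumes "smooth_atlas A" and "simply_connected (UNIV :: 'a set)"
    and "signature_4_2 B"
    and "legendre_map A B f"
    and "umbilic_free_with A f s T"
    and "projective_immersion A (s 1)" and "projective_immersion A (s 2)"
    and "lie_applicable A B f"
    and "i \<in> {1, 2}"
  shows "\<forall>t g. calapso_transform A B f t g \<longrightarrow>
    (spherical_curvature_lines A B f (T i) \<longleftrightarrow> spherical_curvature_lines A B g (T i))"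
proof (intro allI impI)
  fix t g assume "calapso_transform A B f t g"
  then obtain \<eta> G where \<eta>: "gauge_potential A B f \<eta>" and gauge: "trivialising_gauge A B \<eta> t G"
    and "\<forall>x. g x = (\<lambda>v. G x *v v) ` f x"
    unfolding calapso_transform_def by blast
  then have g: "g = (\<lambda>x. (\<lambda>v. G x *v v) ` f x)" by blast
  note orth = gauge_orthogonal[OF gauge]
  have inv: "smooth_map A UNIV (\<lambda>p. matrix_inv (G p))"
    by (rule smooth_map_orthogonal_inv[OF assms(1,3) open_UNIV gauge_smooth[OF gauge] orth])
  note inv_mem = orthogonal_inv_mem[OF assms(3) orth]
  note setting = assms(1,3,4) \<eta> gauge assms(5)
  have lines: "curvature_lines A F (T i)" if "umbilic_free_with A F s' T" for F s'
    unfolding curvature_lines_def using that assms(9) by blast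
  have pos: "B (M *v v) (M *v v) > 0"
    if "M \<in> orthogonal_group B" "\<forall>v\<in>V. v \<noteq> 0 \<longrightarrow> B v v > 0" "v \<in> V" "M *v v \<noteq> 0" for M V v
    using that unfolding orthogonal_group_def by auto
  show "spherical_curvature_lines A B f (T i) \<longleftrightarrow> spherical_curvature_lines A B g (T i)"
  proof
    assume "spherical_curvature_lines A B f (T i)"
    then obtain L where L: "subbundle A 1 L" "\<And>x. L x \<subseteq> perp B (f x)"
      "\<And>x. \<forall>v\<in>L x. v \<noteq> 0 \<longrightarrow> B v v > 0" "\<And>x y. y \<in> leaf A (T i) x \<Longrightarrow> L y = L x"
      unfolding spherical_curvature_lines_def by blast
    define L' where "L' = (\<lambda>x. (\<lambda>v. G x *v v) ` L x)"
    have "subbundle A 1 L'"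
      unfolding L'_def by (rule subbundle_orthogonal_image[OF assms(1,3) gauge_smooth[OF gauge] orth L(1)])
    moreover have "L' x \<subseteq> perp B (g x)" for x
      using perp_orthogonal_image[OF orth] L(2) unfolding L'_def g by blast
    moreover have "\<forall>v\<in>L' x. v \<noteq> 0 \<longrightarrow> B v v > 0" for x
      using pos[OF orth L(3)] unfolding L'_def by blast
    moreover have "L' y = L' x" if "y \<in> leaf A (T i) x" for x y
      unfolding L'_def by (rule gauge_constant_on_leaves[OF setting assms(9) L(2,4) that])
    moreover have "legendre_map A B g" "curvature_lines A g (T i)"
      unfolding g by (rule calapso_legendre[OF setting(1-5)], rule lines[OF calapso_umbilic_free[OF setting]])
    ultimately show "spherical_curvature_lines A B g (T i)"
      unfolding spherical_curvature_lines_def by blast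
  next
    assume "spherical_curvature_lines A B g (T i)"
    then obtain L where L: "subbundle A 1 L" "\<And>x. L x \<subseteq> perp B (g x)"
      "\<And>x. \<forall>v\<in>L x. v \<noteq> 0 \<longrightarrow> B v v > 0" "\<And>x y. y \<in> leaf A (T i) x \<Longrightarrow> L y = L x"
      unfolding spherical_curvature_lines_def by blast
    define L' where "L' = (\<lambda>x. (\<lambda>v. matrix_inv (G x) *v v) ` L x)"
    have "subbundle A 1 L'"
      unfolding L'_def by (rule subbundle_orthogonal_image[OF assms(1,3) inv inv_mem L(1)])
    moreover have "L' x \<subseteq> perp B (f x)" for x
    proof -
      have "L' x \<subseteq> perp B ((\<lambda>v. matrix_inv (G x) *v v) ` g x)"
        using perp_orthogonal_image[OF inv_mem] L(2) unfolding L'_def by blast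
      then show ?thesis by (simp add: g image_image orthogonal_inv_left[OF assms(3) orth])
    qed
    moreover have "\<forall>v\<in>L' x. v \<noteq> 0 \<longrightarrow> B v v > 0" for x
      using pos[OF inv_mem L(3)] unfolding L'_def by blast
    moreover have "L' y = L' x" if "y \<in> leaf A (T i) x" for x y
      unfolding L'_def by (rule gauge_inverse_constant_on_leaves[OF setting assms(9) L(2)[unfolded g] L(4) that])
    ultimately show "spherical_curvature_lines A B f (T i)"
      unfolding spherical_curvature_lines_def using assms(4) lines[OF assms(5)] by blast
  qed
qed

end
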